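(* Let $\{B(t):t\in\mathbb R\}$ be a standard two-sided Brownian motion and let $\mathbf c=(c_+,c_-)\in\mathbb R^2\setminus\{(0,0)\}$. Then $\{\tilde X^{\mathbf c}_H(t):(H,t)\in(0,1)\times[0,\infty)\}$, $\tilde X^{\mathbf c}_H(t):=c_+\tilde X_H^+(t)+c_-\tilde X_H^-(t)$, is a continuous modification of $\{X^{\mathbf c}_H(t):(H,t)\in(0,1)\times[0,\infty)\}$, $X^{\mathbf c}_H(t):=c_+X_H^+(t)+c_-X_H^-(t)$.
   Context: For $(H,t)\in(0,1)\times[0,\infty)$ define the Wiener integrals $$X^+_H(t)=\int_{-\infty}^0\big[(t-s)^{H-\frac12}-(-s)^{H-\frac12}\big]dB(s)+\int_0^t(t-s)^{H-\frac12}dB(s),$$ $$X^-_H(t)=-\int_0^ts^{H-\frac12}dB(s)-\int_t^\infty\big[s^{H-\frac12}-(s-t)^{H-\frac12}\big]dB(s),$$ and the pathwise Lebesgue integrals $$\tilde X_H^+(t)=t^{H-\frac12}B(t)-(H-\tfrac12)\int_0^t(t-s)^{H-\frac32}\big(B(t)-B(s)\big)ds+(H-\tfrac12)\int_{-\infty}^0\big[(t-s)^{H-\frac32}-(-s)^{H-\frac32}\big]B(s)\,ds,$$ $$\tilde X_H^-(t)=-t^{H-\frac12}B(t)+(H-\tfrac12)\int_0^ts^{H-\frac32}B(s)\,ds+(H-\tfrac12)\int_t^\infty\big[s^{H-\frac32}-(s-t)^{H-\frac32}\big]\big(B(s)-B(t)\big)ds.$$ At $t=0$ all four quantities are taken to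 be $0$. A field $\tilde X$ is a continuous modification of $X$ if almost every sample path of $\tilde X$ is (jointly) continuous in $(H,t)$ and, for every fixed $(H,t)$, $\tilde X_H(t)=X_H(t)$ almost surely. *)

theory Defs
  imports "HOL-Probability.Probability"
begin

definition two_sided_BM :: "'w measure \<Rightarrow> (real \<Rightarrow> 'w \<Rightarrow> real) \<Rightarrow> bool" where
  "two_sided_BM M B \<longleftrightarrow>
     prob_space M \<and>
     (\<forall>t. B t \<in> borel_measurable M) \<and>
     (AE \<omega> in M. B 0 \<omega> = 0) \<and>
     (\<forall>n. \<forall>\<tau> :: nat \<Rightarrow> real. strict_mono_on {..n} \<tau> \<longrightarrow>
        prob_space.indep_vars M (\<lambda>_. borel) (\<lambda>i \<omega>. B (\<tau> (Suc i)) \<omega> - B (\<tau> i) \<omega>) {..<n}) \<and>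
     (\<forall>s t. s < t \<longrightarrow>
        distributed M lborel (\<lambda>\<omega>. B t \<omega> - B s \<omega>) (\<lambda>x. ennreal (normal_density 0 (sqrt (t - s)) x))) \<and>
     (AE \<omega> in M. continuous_on UNIV (\<lambda>t. B t \<omega>))"

text \<open>A list of triples \<open>(a, l, r)\<close> with \<open>l \<le> r\<close> encodes the step function
  \<open>\<Sum> a * indicator {l<..r}\<close>, whose integral against \<open>B\<close> is \<open>\<Sum> a * (B r - B l)\<close>.
  The intervals may overlap.\<close>

type_synonym step = "(real \<times> real \<times> real) list"

definition is_step :: "step \<Rightarrow> bool" where
  "is_step ps \<longleftrightarrow> (\<forall>(a, l, r) \<in> set ps. l \<le> r)"

definition step_fun :: "step \<Rightarrow> real \<Rightarrow> real" where
  "step_fun ps s = (\<Sum>(a, l, r)\<leftarrow>ps. a * indicator {l<..r} s)"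

definition step_integral :: "(real \<Rightarrow> 'w \<Rightarrow> real) \<Rightarrow> step \<Rightarrow> 'w \<Rightarrow> real" where
  "step_integral B ps \<omega> = (\<Sum>(a, l, r)\<leftarrow>ps. a * (B r \<omega> - B l \<omega>))"

definition square_integrable :: "'a measure \<Rightarrow> ('a \<Rightarrow> real) \<Rightarrow> bool" where
  "square_integrable M f \<longleftrightarrow> f \<in> borel_measurable M \<and> integrable M (\<lambda>x. (f x)\<^sup>2)"

text \<open>The Wiener integral of a deterministic \<open>f\<close> in \<open>L\<^sup>2\<close> of the line is the \<open>L\<^sup>2\<close> limit of the
  integrals of step functions that converge to \<open>f\<close> in \<open>L\<^sup>2\<close>; it is determined up to almost sure
  equality, and \<open>wiener_integral\<close> picks one version.\<close>

definition has_wiener_integral ::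
  "'w measure \<Rightarrow> (real \<Rightarrow> 'w \<Rightarrow> real) \<Rightarrow> (real \<Rightarrow> real) \<Rightarrow> ('w \<Rightarrow> real) \<Rightarrow> bool" where
  "has_wiener_integral M B f Y \<longleftrightarrow>
     square_integrable lborel f \<and> square_integrable M Y \<and>
     (\<exists>S :: nat \<Rightarrow> step.
        (\<forall>n. is_step (S n)) \<and>
        (\<lambda>n. LINT s|lborel. (step_fun (S n) s - f s)\<^sup>2) \<longlonglongrightarrow> 0 \<and>
        (\<lambda>n. LINT \<omega>|M. (step_integral B (S n) \<omega> - Y \<omega>)\<^sup>2) \<longlonglongrightarrow> 0)"

definition wiener_integral ::
  "'w measure \<Rightarrow> (real \<Rightarrow> 'w \<Rightarrow> real) \<Rightarrow> real set \<Rightarrow> (real \<Rightarrow> real) \<Rightarrow> 'w \<Rightarrow> real" where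
  "wiener_integral M B A f = (SOME Y. has_wiener_integral M B (\<lambda>s. indicator A s * f s) Y)"

text \<open>Below, integrands are only relevant up to null sets, so including endpoints in the domains
  (where \<open>0 powr a = 0\<close>) is harmless.\<close>

definition X_plus :: "'w measure \<Rightarrow> (real \<Rightarrow> 'w \<Rightarrow> real) \<Rightarrow> real \<Rightarrow> real \<Rightarrow> 'w \<Rightarrow> real" where
  "X_plus M B H t \<omega> =
     (if t = 0 then 0
      else wiener_integral M B {..0} (\<lambda>s. (t - s) powr (H - 1/2) - (- s) powr (H - 1/2)) \<omega>
         + wiener_integral M B {0..t} (\<lambda>s. (t - s) powr (H - 1/2)) \<omega>)"

definition X_minus :: "'w measure \<Rightarrow> (real \<Rightarrow> 'w \<Rightarrow> real) \<Rightarrow> real \<Rightarrow> real \<Rightarrow> 'w \<Rightarrow> real" where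
  "X_minus M B H t \<omega> =
     (if t = 0 then 0
      else - wiener_integral M B {0..t} (\<lambda>s. s powr (H - 1/2)) \<omega>
         - wiener_integral M B {t..} (\<lambda>s. s powr (H - 1/2) - (s - t) powr (H - 1/2)) \<omega>)"

definition tX_plus :: "(real \<Rightarrow> real) \<Rightarrow> real \<Rightarrow> real \<Rightarrow> real" where
  "tX_plus b H t =
     (if t = 0 then 0
      else t powr (H - 1/2) * b t
         - (H - 1/2) * (LINT s:{0..t}|lborel. (t - s) powr (H - 3/2) * (b t - b s))
         + (H - 1/2) * (LINT s:{..0}|lborel. ((t - s) powr (H - 3/2) - (- s) powr (H - 3/2)) * b s))"

definition tX_minus :: "(real \<Rightarrow> real) \<Rightarrow> real \<Rightarrow> real \<Rightarrow> real" where
  "tX_minus b H t =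
     (if t = 0 then 0
      else - (t powr (H - 1/2) * b t)
         + (H - 1/2) * (LINT s:{0..t}|lborel. s powr (H - 3/2) * b s)
         + (H - 1/2) * (LINT s:{t..}|lborel.
             (s powr (H - 3/2) - (s - t) powr (H - 3/2)) * (b s - b t)))"

definition X_field ::
  "'w measure \<Rightarrow> (real \<Rightarrow> 'w \<Rightarrow> real) \<Rightarrow> real \<times> real \<Rightarrow> real \<times> real \<Rightarrow> 'w \<Rightarrow> real" where
  "X_field M B c = (\<lambda>(H, t) \<omega>. fst c * X_plus M B H t \<omega> + snd c * X_minus M B H t \<omega>)"

definition tX_field ::
  "(real \<Rightarrow> 'w \<Rightarrow> real) \<Rightarrow> real \<times> real \<Rightarrow> real \<times> real \<Rightarrow> 'w \<Rightarrow> real" where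
  "tX_field B c = (\<lambda>(H, t) \<omega>.
     fst c * tX_plus (\<lambda>s. B s \<omega>) H t + snd c * tX_minus (\<lambda>s. B s \<omega>) H t)"

definition continuous_modification ::
  "'w measure \<Rightarrow> 'i::topological_space set \<Rightarrow> ('i \<Rightarrow> 'w \<Rightarrow> real) \<Rightarrow> ('i \<Rightarrow> 'w \<Rightarrow> real) \<Rightarrow> bool" where
  "continuous_modification M T Y X \<longleftrightarrow>
     (AE \<omega> in M. continuous_on T (\<lambda>p. Y p \<omega>)) \<and>
     (\<forall>p\<in>T. AE \<omega> in M. Y p \<omega> = X p \<omega>)"

end

theory Submission
  imports Defs "HOL-Real_Asymp.Real_Asymp"
begin

text \<open>Pathwise part: with \<open>u = \<bar>s - r\<bar>\<close> the distance to the anchor \<open>r \<in> {0, t}\<close>, every integral in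
  \<open>tX_plus\<close> and \<open>tX_minus\<close> becomes \<open>\<integral> \<kappa>\<^bsub>H,t\<^esub>(u) (b (r \<plusminus> u) - b r) du\<close> over \<open>u > 0\<close>, for one of two kernels
  \<open>\<kappa>\<close>. Almost every path is locally Hoelder of every order below \<open>1/2\<close> and grows more slowly than
  every power above \<open>1/2\<close>, so dominated convergence gives joint continuity in \<open>(H, t)\<close>.

  Identification: for fixed \<open>(H, t)\<close> these integrals are discretised along a grid in \<open>u\<close>. The result is
  the integral of a step function, and Minkowski's integral inequality bounds its \<open>L\<^sup>2\<close> error by
  \<open>\<integral> \<bar>\<kappa>(u)\<bar> \<surd>\<bar>\<lfloor>u\<rfloor>\<^sub>n - u\<bar> du\<close>. Only \<open>E (B u - B v)\<^sup>2 = \<bar>u - v\<bar>\<close> enters, and the functions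
  \<open>s \<mapsto> 1{s \<le> u}\<close> satisfy the same identity in \<open>L\<^sup>2\<close> of the line; so one argument yields the convergence of
  the random variables and of the integrands.\<close>

subsection \<open>Processes with linear variogram\<close>

text \<open>Both kernels are of order u^(H - 3/2) at 0, hence not integrable there for H < 1/2. An
  increment from the anchor contributes a factor sqrt u in L^2, and pathwise a power slightly below
  1/2 at 0 and slightly above 1/2 at infinity. This leaves exponents near H - 1 at 0 and, for the
  far kernel, near H - 2 at infinity, and these are integrable exactly for 0 < H < 1. The integrals
  are therefore never split into a part with B(s) and a part with B(r). The kernels come from
  writing the powers with exponent H - 1/2 as tail integrals of their derivatives. The factor H -
  1/2 is always multiplied by, never divided by, so H = 1/2 is no special case. One kernel is cut
  off at u = t; the constant t^(H - 1/2) that its tail integrals then lack is the origin of the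
  terms with t^(H - 1/2) B(t). Two obstacles remain. \<open>wiener_integral\<close> is a choice by
  \<open>SOME\<close>, so evaluating it takes existence and uniqueness. The paths are continuous
  only almost surely, so the joint measurability behind Fubini has to come from a modified
  process.\<close>

lemma ennreal_power2_le_imp_le:
  fixes x y :: ennreal
  assumes "x\<^sup>2 \<le> y\<^sup>2"
  shows "x \<le> y"
proof (cases x)
  case (real a)
  show ?thesis
  proof (cases y)
    case (real b)
    with \<open>x = ennreal a\<close> \<open>0 \<le> a\<close> assms have "a\<^sup>2 \<le> b\<^sup>2"
      by (simp add: ennreal_power)
    then have "a \<le> b" using real(1) by (rule power2_le_imp_le)
    with real \<open>x = ennreal a\<close> show ?thesis by (simp add: ennreal_leI)
  qed simp
next
  case top
  then have "y\<^sup>2 = top" using assms by (simp add: power2_eq_square top_unique)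
  then show ?thesis by (cases y) (auto simp: ennreal_power)
qed

text \<open>The square of the inner integral is a double integral over u and v. Fubini moves the
  integral over \<open>N\<close> inside, where Cauchy-Schwarz bounds it by \<open>w u * w v\<close>,
  and the double integral of this product factors. Since \<open>w\<close> is any measurable majorant
  of the L^2 norms, their own measurability in u is never an issue.\<close>

lemma nn_integral_Minkowski:
  fixes h :: "'a \<Rightarrow> 'b \<Rightarrow> ennreal"
  assumes "sigma_finite_measure A" "sigma_finite_measure N"
    and h[measurable]: "case_prod h \<in> borel_measurable (A \<Otimes>\<^sub>M N)"
    and w[measurable]: "w \<in> borel_measurable A"
    and bound: "\<And>u. (\<integral>\<^sup>+x. (h u x)\<^sup>2 \<partial>N) \<le> (w u)\<^sup>2"
  shows "(\<integral>\<^sup>+x. (\<integral>\<^sup>+u. h u x \<partial>A)\<^sup>2 \<partial>N) \<le> (\<integral>\<^sup>+u. w u \<partial>A)\<^sup>2"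
proof -
  interpret A: sigma_finite_measure A by fact
  interpret N: sigma_finite_measure N by fact
  interpret AN: pair_sigma_finite A N ..
  interpret P: pair_sigma_finite "A \<Otimes>\<^sub>M A" N
    by (rule pair_sigma_finite.intro[OF sigma_finite_pair_measure])
       (use assms in auto)
  interpret AA: pair_sigma_finite A A ..
  have hm[measurable]: "h u \<in> borel_measurable N" if "u \<in> space A" for u
    using h that by measurable
  have CS: "(\<integral>\<^sup>+x. h u x * h v x \<partial>N) \<le> w u * w v" if "u \<in> space A" "v \<in> space A" for u v
  proof (rule ennreal_power2_le_imp_le)
    have "(\<integral>\<^sup>+x. h u x * h v x \<partial>N)\<^sup>2 \<le> (\<integral>\<^sup>+x. (h u x)\<^sup>2 \<partial>N) * (\<integral>\<^sup>+x. (h v x)\<^sup>2 \<partial>N)"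
      using that by (intro Cauchy_Schwarz_nn_integral) auto
    also have "\<dots> \<le> (w u)\<^sup>2 * (w v)\<^sup>2"
      by (intro mult_mono bound) auto
    finally show "(\<integral>\<^sup>+x. h u x * h v x \<partial>N)\<^sup>2 \<le> (w u * w v)\<^sup>2"
      by (simp add: power_mult_distrib)
  qed
  have "(\<integral>\<^sup>+x. (\<integral>\<^sup>+u. h u x \<partial>A)\<^sup>2 \<partial>N) = (\<integral>\<^sup>+x. (\<integral>\<^sup>+u. (\<integral>\<^sup>+v. h u x * h v x \<partial>A) \<partial>A) \<partial>N)"
    by (intro nn_integral_cong)
       (simp add: power2_eq_square nn_integral_cmult nn_integral_multc)
  also have "\<dots> = (\<integral>\<^sup>+x. (\<integral>\<^sup>+p. h (fst p) x * h (snd p) x \<partial>(A \<Otimes>\<^sub>M A)) \<partial>N)"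
    by (intro nn_integral_cong) (simp add: A.nn_integral_fst[symmetric])
  also have "\<dots> = (\<integral>\<^sup>+p. (\<integral>\<^sup>+x. h (fst p) x * h (snd p) x \<partial>N) \<partial>(A \<Otimes>\<^sub>M A))"
    by (rule P.Fubini') measurable
  also have "\<dots> \<le> (\<integral>\<^sup>+p. w (fst p) * w (snd p) \<partial>(A \<Otimes>\<^sub>M A))"
    by (intro nn_integral_mono CS) (auto simp: space_pair_measure)
  also have "\<dots> = (\<integral>\<^sup>+u. w u \<partial>A)\<^sup>2"
    by (simp add: A.nn_integral_fst[symmetric] nn_integral_cmult nn_integral_multc power2_eq_square)
  finally show ?thesis .
qed

text \<open>The measure is only sigma-finite because Lebesgue measure has to be an instance beside
  the probability space. Stating the variogram as a nonnegative integral makes square integrability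
  of the increments part of the assumption.\<close>

locale linear_variogram = sigma_finite_measure N for N :: "'a measure" +
  fixes Z :: "real \<Rightarrow> 'a \<Rightarrow> real"
  assumes meas [measurable]: "\<And>u. Z u \<in> borel_measurable N"
    and variogram: "\<And>u v. (\<integral>\<^sup>+x. ennreal ((Z u x - Z v x)\<^sup>2) \<partial>N) = ennreal \<bar>u - v\<bar>"
begin

lemma has_bochner_integral_variogram:
  "has_bochner_integral N (\<lambda>x. (Z u x - Z v x)\<^sup>2) \<bar>u - v\<bar>"
  by (rule has_bochner_integral_nn_integral) (auto simp: variogram)

text \<open>Polarisation: the inner product of two increments is a combination of four variograms.\<close>

lemma has_bochner_integral_increments:
  "has_bochner_integral N (\<lambda>x. (Z r x - Z l x) * (Z r' x - Z l' x))
     ((\<bar>r - l'\<bar> + \<bar>l - r'\<bar> - \<bar>r - r'\<bar> - \<bar>l - l'\<bar>) / 2)"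
proof -
  have "has_bochner_integral N
      (\<lambda>x. ((Z r x - Z l' x)\<^sup>2 + (Z l x - Z r' x)\<^sup>2 - (Z r x - Z r' x)\<^sup>2 - (Z l x - Z l' x)\<^sup>2) / 2)
      ((\<bar>r - l'\<bar> + \<bar>l - r'\<bar> - \<bar>r - r'\<bar> - \<bar>l - l'\<bar>) / 2)"
    by (intro has_bochner_integral_divide has_bochner_integral_diff has_bochner_integral_add
        has_bochner_integral_variogram)
  moreover have "((Z r x - Z l' x)\<^sup>2 + (Z l x - Z r' x)\<^sup>2 - (Z r x - Z r' x)\<^sup>2 - (Z l x - Z l' x)\<^sup>2) / 2
      = (Z r x - Z l x) * (Z r' x - Z l' x)" for x
    by (simp add: power2_eq_square field_simps)
  ultimately show ?thesis by simp
qed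

text \<open>The point is the right-hand side: it is computed from the two lists alone and mentions
  neither \<open>Z\<close> nor \<open>N\<close>, so it is the same for all processes with linear
  variogram.\<close>

lemma has_bochner_integral_step_mult:
  "has_bochner_integral N (\<lambda>x. step_integral Z ps x * step_integral Z qs x)
     (\<Sum>(a, l, r)\<leftarrow>ps. \<Sum>(a', l', r')\<leftarrow>qs.
        a * a' * ((\<bar>r - l'\<bar> + \<bar>l - r'\<bar> - \<bar>r - r'\<bar> - \<bar>l - l'\<bar>) / 2))"
proof -
  have 1: "has_bochner_integral N (\<lambda>x. a * (Z r x - Z l x) * step_integral Z qs x)
     (\<Sum>(a', l', r')\<leftarrow>qs. a * a' * ((\<bar>r - l'\<bar> + \<bar>l - r'\<bar> - \<bar>r - r'\<bar> - \<bar>l - l'\<bar>) / 2))" for a l r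
  proof (induction qs)
    case Nil
    then show ?case by (simp add: step_integral_def has_bochner_integral_zero)
  next
    case (Cons q qs)
    obtain a' l' r' where q: "q = (a', l', r')" by (cases q)
    have "has_bochner_integral N
        (\<lambda>x. a * a' * ((Z r x - Z l x) * (Z r' x - Z l' x)) + a * (Z r x - Z l x) * step_integral Z qs x)
        (a * a' * ((\<bar>r - l'\<bar> + \<bar>l - r'\<bar> - \<bar>r - r'\<bar> - \<bar>l - l'\<bar>) / 2) +
        (\<Sum>(a', l', r')\<leftarrow>qs. a * a' * ((\<bar>r - l'\<bar> + \<bar>l - r'\<bar> - \<bar>r - r'\<bar> - \<bar>l - l'\<bar>) / 2)))"
      by (intro has_bochner_integral_add Cons.IH has_bochner_integral_mult_right
          has_bochner_integral_increments)
    then show ?case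
      by (simp add: q step_integral_def algebra_simps)
  qed
  show ?thesis
  proof (induction ps)
    case Nil
    then show ?case by (simp add: step_integral_def has_bochner_integral_zero)
  next
    case (Cons p ps)
    obtain a l r where p: "p = (a, l, r)" by (cases p)
    from has_bochner_integral_add[OF 1[of a r l] Cons.IH]
    show ?case by (simp add: p step_integral_def algebra_simps)
  qed
qed

lemma step_integral_measurable [measurable]: "step_integral Z ps \<in> borel_measurable N"
proof -
  have "step_integral Z ps = (\<lambda>x. \<Sum>(a, l, r)\<leftarrow>ps. a * (Z r x - Z l x))"
    by (auto simp: step_integral_def)
  also have "\<dots> \<in> borel_measurable N"
    by (induction ps) auto
  finally show ?thesis .
qed

end

section \<open>The isometry and its deterministic model\<close>

text \<open>Both second moments equal the same expression in the list \<open>ps\<close>. For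
  Brownian motion and \<open>heaviside\<close> this is the Wiener isometry on step
  functions.\<close>

lemma step_isometry:
  assumes "linear_variogram N Z" "linear_variogram N' Z'"
  shows "integrable N (\<lambda>x. (step_integral Z ps x)\<^sup>2)"
    and "(LINT x|N. (step_integral Z ps x)\<^sup>2) = (LINT x|N'. (step_integral Z' ps x)\<^sup>2)"
  using linear_variogram.has_bochner_integral_step_mult[OF assms(1), of ps ps]
    linear_variogram.has_bochner_integral_step_mult[OF assms(2), of ps ps]
  by (auto simp: power2_eq_square has_bochner_integral_iff)

text \<open>The deterministic counterpart of Brownian motion: for l <= r the difference of the
  values at r and l is the indicator of (l, r]. Only such differences lie in L^2 of the line, not
  \<open>heaviside u\<close> itself.\<close>

definition heaviside :: "real \<Rightarrow> real \<Rightarrow> real" where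
  "heaviside u s = (if s \<le> u then 1 else 0)"

lemma heaviside_measurable [measurable]: "(\<lambda>(u, s). heaviside u s) \<in> borel_measurable (borel \<Otimes>\<^sub>M borel)"
  unfolding heaviside_def by measurable

interpretation heaviside: linear_variogram lborel heaviside
proof
  show "heaviside u \<in> borel_measurable lborel" for u
    unfolding heaviside_def by measurable
  have *: "(\<integral>\<^sup>+s. ennreal ((heaviside u s - heaviside v s)\<^sup>2) \<partial>lborel) = ennreal \<bar>u - v\<bar>"
    if "v \<le> u" for u v
  proof -
    have "(\<integral>\<^sup>+s. ennreal ((heaviside u s - heaviside v s)\<^sup>2) \<partial>lborel) =
        (\<integral>\<^sup>+s. indicator {v<..u} s \<partial>lborel)"
      using that by (intro nn_integral_cong) (auto simp: heaviside_def indicator_def)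
    then show ?thesis using that by simp
  qed
  show "(\<integral>\<^sup>+s. ennreal ((heaviside u s - heaviside v s)\<^sup>2) \<partial>lborel) = ennreal \<bar>u - v\<bar>" for u v
    using *[of u v] *[of v u] by (cases "v \<le> u") (auto simp: power2_commute abs_minus_commute)
qed

text \<open>It lets the integrand side of \<open>has_wiener_integral\<close> be treated as a second
  process. The order of the endpoints matters: for l > r the interval is empty, whereas the
  difference of Heaviside functions is -1 on (r, l].\<close>

lemma step_fun_eq_step_integral: "is_step ps \<Longrightarrow> step_fun ps s = step_integral heaviside ps s"
  unfolding step_fun_def step_integral_def
  by (rule arg_cong[of _ _ sum_list], rule map_cong[OF refl])
     (auto simp: is_step_def heaviside_def indicator_def)

subsection \<open>Uniqueness of the Wiener integral\<close>

lemma square_integrable_add: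
  assumes "square_integrable M f" "square_integrable M g"
  shows "square_integrable M (\<lambda>x. f x + g x)"
  unfolding square_integrable_def
proof
  from assms show [measurable]: "(\<lambda>x. f x + g x) \<in> borel_measurable M"
    by (auto simp: square_integrable_def)
  have "integrable M (\<lambda>x. 2 * (f x)\<^sup>2 + 2 * (g x)\<^sup>2)"
    using assms by (auto simp: square_integrable_def)
  then show "integrable M (\<lambda>x. (f x + g x)\<^sup>2)"
  proof (rule Bochner_Integration.integrable_bound)
    have "(f x + g x)\<^sup>2 \<le> 2 * (f x)\<^sup>2 + 2 * (g x)\<^sup>2" for x
      using zero_le_power2[of "f x - g x"] by (simp add: power2_eq_square algebra_simps)
    then show "AE x in M. norm ((f x + g x)\<^sup>2) \<le> norm (2 * (f x)\<^sup>2 + 2 * (g x)\<^sup>2)"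
      by (auto intro: order_trans[OF _ abs_ge_self])
  qed measurable
qed

lemma square_integrable_diff:
  assumes "square_integrable M f" "square_integrable M g"
  shows "square_integrable M (\<lambda>x. f x - g x)"
proof -
  have "square_integrable M (\<lambda>x. - g x)"
    using assms(2) unfolding square_integrable_def by simp
  from square_integrable_add[OF assms(1) this] show ?thesis by simp
qed

text \<open>From (a + b)^2 <= 2 a^2 + 2 b^2. Constants are harmless because the bounds are only used
  along sequences tending to 0, and no square roots of integrals appear.\<close>

lemma square_distance_triangle:
  fixes f g h :: "'a \<Rightarrow> real"
  assumes "square_integrable M f" "square_integrable M g" "square_integrable M h"
  shows "(LINT x|M. (f x - h x)\<^sup>2) \<le> 2 * (LINT x|M. (f x - g x)\<^sup>2) + 2 * (LINT x|M. (g x - h x)\<^sup>2)"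
proof -
  have [simp]: "integrable M (\<lambda>x. (f x - h x)\<^sup>2)" "integrable M (\<lambda>x. (f x - g x)\<^sup>2)"
    "integrable M (\<lambda>x. (g x - h x)\<^sup>2)"
    using square_integrable_diff[OF assms(1,3)] square_integrable_diff[OF assms(1,2)]
      square_integrable_diff[OF assms(2,3)] unfolding square_integrable_def by blast+
  have "(f x - h x)\<^sup>2 \<le> 2 * (f x - g x)\<^sup>2 + 2 * (g x - h x)\<^sup>2" for x
    using zero_le_power2[of "(f x - g x) - (g x - h x)"] by (simp add: power2_eq_square algebra_simps)
  then have "(LINT x|M. (f x - h x)\<^sup>2) \<le> (LINT x|M. 2 * (f x - g x)\<^sup>2 + 2 * (g x - h x)\<^sup>2)"
    by (intro integral_mono) simp_all
  also have "\<dots> = 2 * (LINT x|M. (f x - g x)\<^sup>2) + 2 * (LINT x|M. (g x - h x)\<^sup>2)"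
    by simp
  finally show ?thesis .
qed

lemma step_integral_append:
  "step_integral Z (ps @ qs) x = step_integral Z ps x + step_integral Z qs x"
  by (simp add: step_integral_def)

lemma step_integral_scale:
  "step_integral Z (map (\<lambda>(a, l, r). (c * a, l, r)) ps) x = c * step_integral Z ps x"
proof (induction ps)
  case (Cons p ps)
  obtain a l r where "p = (a, l, r)" by (cases p)
  with Cons.IH show ?case by (simp add: step_integral_def algebra_simps)
qed (simp add: step_integral_def)

lemma is_step_append: "is_step ps \<Longrightarrow> is_step qs \<Longrightarrow> is_step (ps @ qs)"
  by (auto simp: is_step_def)

text \<open>A step integral reads the process at finitely many times, so equality at each fixed time
  suffices. The conclusion equates the predicates themselves, so that \<open>SOME\<close> picks the
  same version for both processes.\<close>

lemma has_wiener_integral_cong_AE_process: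
  assumes [measurable]: "\<And>t. B t \<in> borel_measurable M" "\<And>t. B' t \<in> borel_measurable M"
    and eq: "\<And>t. AE \<omega> in M. B t \<omega> = B' t \<omega>"
  shows "has_wiener_integral M B = has_wiener_integral M B'"
proof -
  have meas[measurable]: "step_integral B ps \<in> borel_measurable M"
    if [measurable]: "\<And>t. B t \<in> borel_measurable M" for ps and B :: "real \<Rightarrow> 'a \<Rightarrow> real"
  proof -
    have "step_integral B ps = (\<lambda>x. \<Sum>(a, l, r)\<leftarrow>ps. a * (B r x - B l x))"
      by (auto simp: step_integral_def)
    also have "\<dots> \<in> borel_measurable M"
      by (induction ps) auto
    finally show ?thesis .
  qed
  have AE: "AE \<omega> in M. step_integral B ps \<omega> = step_integral B' ps \<omega>" for ps
  proof (induction ps)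
    case (Cons p ps)
    obtain a l r where p: "p = (a, l, r)" by (cases p)
    from Cons.IH eq[of l] eq[of r] show ?case
      by eventually_elim (simp add: step_integral_def p)
  qed (simp add: step_integral_def)
  have "(LINT \<omega>|M. (step_integral B ps \<omega> - Y \<omega>)\<^sup>2) = (LINT \<omega>|M. (step_integral B' ps \<omega> - Y \<omega>)\<^sup>2)"
    if [measurable]: "Y \<in> borel_measurable M" for ps Y
    by (rule integral_cong_AE) (use AE[of ps] in \<open>auto\<close>)
  then show ?thesis
    unfolding has_wiener_integral_def square_integrable_def
    by (intro ext) (simp cong: conj_cong)
qed

context linear_variogram
begin

lemma square_integrable_step: "square_integrable N (step_integral Z ps)"
  unfolding square_integrable_def
  by (intro conjI step_integral_measurable step_isometry(1)[OF linear_variogram_axioms linear_variogram_axioms])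

text \<open>The chain from \<open>Y\<close> through the integrals of \<open>S n\<close> and
  \<open>T n\<close> to \<open>Y'\<close> has only one link not small by assumption. The isometry
  turns that link into the distance of the two step functions, which passes through f = g.\<close>

lemma has_wiener_integral_unique:
  assumes Y: "has_wiener_integral N Z f Y" and Y': "has_wiener_integral N Z g Y'"
    and fg: "AE s in lborel. f s = g s"
  shows "AE x in N. Y x = Y' x"
proof -
  from Y obtain S where f: "square_integrable lborel f" "square_integrable N Y"
    and S: "\<And>n. is_step (S n)" "(\<lambda>n. LINT s|lborel. (step_fun (S n) s - f s)\<^sup>2) \<longlonglongrightarrow> 0"
      "(\<lambda>n. LINT x|N. (step_integral Z (S n) x - Y x)\<^sup>2) \<longlonglongrightarrow> 0"
    unfolding has_wiener_integral_def by blast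
  from Y' obtain T where g: "square_integrable lborel g" "square_integrable N Y'"
    and T: "\<And>n. is_step (T n)" "(\<lambda>n. LINT s|lborel. (step_fun (T n) s - g s)\<^sup>2) \<longlonglongrightarrow> 0"
      "(\<lambda>n. LINT x|N. (step_integral Z (T n) x - Y' x)\<^sup>2) \<longlonglongrightarrow> 0"
    unfolding has_wiener_integral_def by blast
  \<comment> \<open>The isometry concerns one list, so the difference of the two step integrals is
    encoded by appending the negated second list to the first.\<close>
  define D where "D n = S n @ map (\<lambda>(a, l, r). (- 1 * a, l, r)) (T n)" for n
  have D: "step_integral W (D n) x = step_integral W (S n) x - step_integral W (T n) x"
    for W :: "real \<Rightarrow> 'c \<Rightarrow> real" and n x
    unfolding D_def step_integral_append step_integral_scale by simp
  have sq: "(\<lambda>s. step_fun (S n) s) = step_integral heaviside (S n)"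
    "(\<lambda>s. step_fun (T n) s) = step_integral heaviside (T n)" for n
    using step_fun_eq_step_integral S(1) T(1) by auto
  have sqint: "square_integrable lborel (step_fun (S n))" "square_integrable lborel (step_fun (T n))" for n
    using heaviside.square_integrable_step by (auto simp: sq)
  have [measurable]: "step_fun (S n) \<in> borel_measurable borel" "step_fun (T n) \<in> borel_measurable borel"
    "f \<in> borel_measurable borel" "g \<in> borel_measurable borel" for n
    using sqint f g by (auto simp: square_integrable_def)
  have Tf: "(LINT s|lborel. (f s - step_fun (T n) s)\<^sup>2) = (LINT s|lborel. (step_fun (T n) s - g s)\<^sup>2)" for n
    by (rule integral_cong_AE) (use fg in \<open>auto simp: power2_commute\<close>)
  have ST: "(LINT x|N. (step_integral Z (S n) x - step_integral Z (T n) x)\<^sup>2) \<le>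
      2 * (LINT s|lborel. (step_fun (S n) s - f s)\<^sup>2) + 2 * (LINT s|lborel. (step_fun (T n) s - g s)\<^sup>2)" for n
  proof -
    have "(LINT x|N. (step_integral Z (S n) x - step_integral Z (T n) x)\<^sup>2) =
        (LINT s|lborel. (step_fun (S n) s - step_fun (T n) s)\<^sup>2)"
      using step_isometry(2)[OF linear_variogram_axioms heaviside.linear_variogram_axioms, of "D n"]
      by (simp add: D sq)
    also have "\<dots> \<le> 2 * (LINT s|lborel. (step_fun (S n) s - f s)\<^sup>2) +
        2 * (LINT s|lborel. (f s - step_fun (T n) s)\<^sup>2)"
      by (intro square_distance_triangle f sqint)
    finally show ?thesis by (simp only: Tf)
  qed
  have YS: "(LINT x|N. (Y x - Y' x)\<^sup>2) \<le> 2 * (LINT x|N. (step_integral Z (S n) x - Y x)\<^sup>2) +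
      2 * (LINT x|N. (step_integral Z (S n) x - Y' x)\<^sup>2)" for n
    using square_distance_triangle[OF f(2) square_integrable_step g(2), of "S n"]
    by (simp only: power2_commute[of "Y _" "step_integral _ _ _"])
  have ST': "(LINT x|N. (step_integral Z (S n) x - Y' x)\<^sup>2) \<le>
      2 * (LINT x|N. (step_integral Z (S n) x - step_integral Z (T n) x)\<^sup>2) +
      2 * (LINT x|N. (step_integral Z (T n) x - Y' x)\<^sup>2)" for n
    by (rule square_distance_triangle[OF square_integrable_step square_integrable_step g(2)])
  have le: "(LINT x|N. (Y x - Y' x)\<^sup>2) \<le> 2 * (LINT x|N. (step_integral Z (S n) x - Y x)\<^sup>2) +
    2 * (2 * (2 * (LINT s|lborel. (step_fun (S n) s - f s)\<^sup>2) + 2 * (LINT s|lborel. (step_fun (T n) s - g s)\<^sup>2))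
      + 2 * (LINT x|N. (step_integral Z (T n) x - Y' x)\<^sup>2))" for n
  proof -
    have "a \<le> 2 * b + 2 * (2 * (2 * f + 2 * g) + 2 * e)"
      if "a \<le> 2 * b + 2 * c" "c \<le> 2 * d + 2 * e" "d \<le> 2 * f + 2 * g" for a b c d e f g :: real
      using that by argo
    from this[OF YS ST' ST] show ?thesis .
  qed
  have "(\<lambda>n. 2 * (LINT x|N. (step_integral Z (S n) x - Y x)\<^sup>2) +
    2 * (2 * (2 * (LINT s|lborel. (step_fun (S n) s - f s)\<^sup>2) + 2 * (LINT s|lborel. (step_fun (T n) s - g s)\<^sup>2))
      + 2 * (LINT x|N. (step_integral Z (T n) x - Y' x)\<^sup>2))) \<longlonglongrightarrow> 2 * 0 + 2 * (2 * (2 * 0 + 2 * 0) + 2 * 0)"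
    by (intro tendsto_intros S T)
  then have "(LINT x|N. (Y x - Y' x)\<^sup>2) \<le> 2 * 0 + 2 * (2 * (2 * 0 + 2 * 0) + 2 * 0)"
    by (rule LIMSEQ_le_const) (use le in blast)
  then have "(LINT x|N. (Y x - Y' x)\<^sup>2) = 0"
    by (intro antisym) auto
  moreover have "integrable N (\<lambda>x. (Y x - Y' x)\<^sup>2)"
    using square_integrable_diff[OF f(2) g(2)] by (simp add: square_integrable_def)
  ultimately have "AE x in N. (Y x - Y' x)\<^sup>2 = 0"
    by (subst (asm) integral_nonneg_eq_0_iff_AE) auto
  then show ?thesis by simp
qed

text \<open>Appending \<open>ps\<close> to every approximating list leaves both errors unchanged.
  This supplies the boundary term t^(H - 1/2) (B t - B 0).\<close>

lemma has_wiener_integral_add_step: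
  assumes Y: "has_wiener_integral N Z f Y" and ps: "is_step ps"
  shows "has_wiener_integral N Z (\<lambda>s. f s + step_fun ps s) (\<lambda>x. Y x + step_integral Z ps x)"
proof -
  from Y obtain S where f: "square_integrable lborel f" "square_integrable N Y"
    and S: "\<And>n. is_step (S n)" "(\<lambda>n. LINT s|lborel. (step_fun (S n) s - f s)\<^sup>2) \<longlonglongrightarrow> 0"
      "(\<lambda>n. LINT x|N. (step_integral Z (S n) x - Y x)\<^sup>2) \<longlonglongrightarrow> 0"
    unfolding has_wiener_integral_def by blast
  have eq: "step_fun ps = step_integral heaviside ps"
    using ps step_fun_eq_step_integral by auto
  have diff: "step_fun (S n @ ps) s - (f s + step_fun ps s) = step_fun (S n) s - f s"
    "step_integral Z (S n @ ps) x - (Y x + step_integral Z ps x) = step_integral Z (S n) x - Y x" for n s x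
    by (simp_all add: step_fun_def step_integral_def)
  have lim: "(\<lambda>n. LINT s|lborel. (step_fun (S n @ ps) s - (f s + step_fun ps s))\<^sup>2) \<longlonglongrightarrow> 0"
    "(\<lambda>n. LINT x|N. (step_integral Z (S n @ ps) x - (Y x + step_integral Z ps x))\<^sup>2) \<longlonglongrightarrow> 0"
    unfolding diff by (fact S)+
  have "square_integrable lborel (step_fun ps)"
    unfolding eq by (rule heaviside.square_integrable_step)
  with f(1) have 1: "square_integrable lborel (\<lambda>s. f s + step_fun ps s)"
    by (rule square_integrable_add)
  have 2: "square_integrable N (\<lambda>x. Y x + step_integral Z ps x)"
    using f(2) square_integrable_step by (rule square_integrable_add)
  have 3: "\<forall>n. is_step (S n @ ps)"
    using is_step_append[OF S(1) ps] by blast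
  have "\<exists>T. (\<forall>n. is_step (T n)) \<and>
      (\<lambda>n. LINT s|lborel. (step_fun (T n) s - (f s + step_fun ps s))\<^sup>2) \<longlonglongrightarrow> 0 \<and>
      (\<lambda>n. LINT x|N. (step_integral Z (T n) x - (Y x + step_integral Z ps x))\<^sup>2) \<longlonglongrightarrow> 0"
    by (rule exI[of _ "\<lambda>n. S n @ ps"], rule conjI[OF 3 conjI[OF lim]])
  then show ?thesis
    unfolding has_wiener_integral_def by (intro conjI 1 2)
qed

end

text \<open>The kernel representation yields the integrands only off one or two points, where the
  conventions for endpoints and for \<open>0 powr a\<close> interfere.\<close>

lemma has_wiener_integral_cong_AE:
  assumes Y: "has_wiener_integral M B f Y" and fg: "AE s in lborel. f s = g s"
    and [measurable]: "g \<in> borel_measurable borel"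
  shows "has_wiener_integral M B g Y"
proof -
  from Y obtain S where f: "square_integrable lborel f" "square_integrable M Y"
    and S: "\<And>n. is_step (S n)" "(\<lambda>n. LINT s|lborel. (step_fun (S n) s - f s)\<^sup>2) \<longlonglongrightarrow> 0"
      "(\<lambda>n. LINT x|M. (step_integral B (S n) x - Y x)\<^sup>2) \<longlonglongrightarrow> 0"
    unfolding has_wiener_integral_def by blast
  have [measurable]: "f \<in> borel_measurable borel" "step_fun (S n) \<in> borel_measurable borel" for n
    using f heaviside.square_integrable_step[of "S n"] step_fun_eq_step_integral[OF S(1)]
    by (auto simp: square_integrable_def cong: measurable_cong)
  have "integrable lborel (\<lambda>s. (g s)\<^sup>2)"
    using f(1) by (subst integrable_cong_AE[where g = "\<lambda>s. (f s)\<^sup>2"])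
      (use fg in \<open>auto simp: square_integrable_def\<close>)
  moreover have "(LINT s|lborel. (step_fun (S n) s - f s)\<^sup>2) = (LINT s|lborel. (step_fun (S n) s - g s)\<^sup>2)" for n
    by (rule integral_cong_AE) (use fg in auto)
  ultimately show ?thesis
    using f S unfolding has_wiener_integral_def
    by (auto simp: square_integrable_def)
qed

locale measurable_linear_variogram = linear_variogram +
  assumes joint_measurable [measurable]: "(\<lambda>(u, x). Z u x) \<in> borel_measurable (borel \<Otimes>\<^sub>M N)"
begin

text \<open>By the variogram, \<open>\<bar>k u\<bar> * sqrt \<bar>e u - e' u\<bar>\<close> is
  exactly the L^2 norm of the integrand at u. General \<open>e\<close> and \<open>e'\<close> cover
  three pairs: point and anchor, grid point and anchor, grid point and point.\<close>

lemma kernel_Minkowski: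
  assumes [measurable]: "k \<in> borel_measurable borel" "e \<in> borel_measurable borel" "e' \<in> borel_measurable borel"
  shows "(\<integral>\<^sup>+x. (\<integral>\<^sup>+u. ennreal \<bar>k u * (Z (e u) x - Z (e' u) x)\<bar> \<partial>lborel)\<^sup>2 \<partial>N) \<le>
    (\<integral>\<^sup>+u. ennreal (\<bar>k u\<bar> * sqrt \<bar>e u - e' u\<bar>) \<partial>lborel)\<^sup>2"
proof (rule nn_integral_Minkowski[OF lborel.sigma_finite_measure_axioms sigma_finite_measure_axioms])
  fix u
  have "(\<integral>\<^sup>+x. (ennreal \<bar>k u * (Z (e u) x - Z (e' u) x)\<bar>)\<^sup>2 \<partial>N) =
      (\<integral>\<^sup>+x. ennreal ((k u)\<^sup>2) * ennreal ((Z (e u) x - Z (e' u) x)\<^sup>2) \<partial>N)"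
    by (intro nn_integral_cong)
       (simp add: ennreal_power power_mult_distrib abs_mult ennreal_mult)
  also have "\<dots> = ennreal ((k u)\<^sup>2) * ennreal \<bar>e u - e' u\<bar>"
    by (simp add: nn_integral_cmult variogram)
  also have "\<dots> = (ennreal (\<bar>k u\<bar> * sqrt \<bar>e u - e' u\<bar>))\<^sup>2"
    by (simp add: ennreal_power power_mult_distrib ennreal_mult)
  finally show "(\<integral>\<^sup>+x. (ennreal \<bar>k u * (Z (e u) x - Z (e' u) x)\<bar>)\<^sup>2 \<partial>N) \<le> (ennreal (\<bar>k u\<bar> * sqrt \<bar>e u - e' u\<bar>))\<^sup>2"
    by simp
qed measurable

lemma kernel_integrable_AE:
  assumes [measurable]: "k \<in> borel_measurable borel" "e \<in> borel_measurable borel" "e' \<in> borel_measurable borel"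
    and int: "integrable lborel (\<lambda>u. k u * sqrt \<bar>e u - e' u\<bar>)"
  shows "AE x in N. integrable lborel (\<lambda>u. k u * (Z (e u) x - Z (e' u) x))"
proof -
  have "(\<integral>\<^sup>+u. ennreal (\<bar>k u\<bar> * sqrt \<bar>e u - e' u\<bar>) \<partial>lborel) < \<infinity>"
    using int by (simp add: integrable_iff_bounded abs_mult)
  then have "(\<integral>\<^sup>+u. ennreal (\<bar>k u\<bar> * sqrt \<bar>e u - e' u\<bar>) \<partial>lborel)\<^sup>2 < \<infinity>"
    by (simp add: power2_eq_square ennreal_mult_less_top)
  with kernel_Minkowski[of k e e']
  have "(\<integral>\<^sup>+x. (\<integral>\<^sup>+u. ennreal \<bar>k u * (Z (e u) x - Z (e' u) x)\<bar> \<partial>lborel)\<^sup>2 \<partial>N) < \<infinity>"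
    by (auto intro: le_less_trans)
  then have "AE x in N. (\<integral>\<^sup>+u. ennreal \<bar>k u * (Z (e u) x - Z (e' u) x)\<bar> \<partial>lborel)\<^sup>2 \<noteq> \<infinity>"
    by (intro nn_integral_noteq_infinite) auto
  with AE_space show ?thesis
  proof eventually_elim
    case (elim x)
    then have "(\<integral>\<^sup>+u. ennreal \<bar>k u * (Z (e u) x - Z (e' u) x)\<bar> \<partial>lborel) < \<infinity>"
      by (auto simp: power2_eq_square ennreal_mult_eq_top_iff less_top[symmetric])
    moreover have "(\<lambda>u. k u * (Z (e u) x - Z (e' u) x)) \<in> borel_measurable lborel"
      using elim by measurable
    ultimately show ?case
      by (simp add: integrable_iff_bounded)
  qed
qed

end

subsection \<open>Integration of a process against a kernel\<close>

context measurable_linear_variogram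
begin

lemma kernel_square_bound:
  fixes k :: "real \<Rightarrow> real"
  assumes [measurable]: "k \<in> borel_measurable borel" "e \<in> borel_measurable borel" "e' \<in> borel_measurable borel"
    and int: "integrable lborel (\<lambda>u. k u * sqrt \<bar>e u - e' u\<bar>)"
  shows "(\<integral>\<^sup>+x. ennreal ((LINT u|lborel. k u * (Z (e u) x - Z (e' u) x))\<^sup>2) \<partial>N)
      \<le> ennreal ((LINT u|lborel. \<bar>k u\<bar> * sqrt \<bar>e u - e' u\<bar>)\<^sup>2)"
proof -
  \<comment> \<open>Where the integrand is not integrable the Bochner integral is 0 by convention,
    so the bound holds for every x without exception.\<close>
  have "ennreal \<bar>LINT u|lborel. f u\<bar> \<le> (\<integral>\<^sup>+u. ennreal \<bar>f u\<bar> \<partial>lborel)" for f :: "real \<Rightarrow> real"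
    using integral_norm_bound_ennreal[of lborel f] not_integrable_integral_eq[of lborel f]
    by (cases "integrable lborel f") auto
  then have le: "ennreal ((LINT u|lborel. f u)\<^sup>2) \<le> (\<integral>\<^sup>+u. ennreal \<bar>f u\<bar> \<partial>lborel)\<^sup>2" for f :: "real \<Rightarrow> real"
    using power_mono[of "ennreal \<bar>LINT u|lborel. f u\<bar>" "\<integral>\<^sup>+u. ennreal \<bar>f u\<bar> \<partial>lborel" 2]
    by (simp add: ennreal_power)
  have "(\<integral>\<^sup>+x. ennreal ((LINT u|lborel. k u * (Z (e u) x - Z (e' u) x))\<^sup>2) \<partial>N)
      \<le> (\<integral>\<^sup>+x. (\<integral>\<^sup>+u. ennreal \<bar>k u * (Z (e u) x - Z (e' u) x)\<bar> \<partial>lborel)\<^sup>2 \<partial>N)"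
    by (intro nn_integral_mono le)
  also have "\<dots> \<le> (\<integral>\<^sup>+u. ennreal (\<bar>k u\<bar> * sqrt \<bar>e u - e' u\<bar>) \<partial>lborel)\<^sup>2"
    by (rule kernel_Minkowski) measurable
  also have "(\<integral>\<^sup>+u. ennreal (\<bar>k u\<bar> * sqrt \<bar>e u - e' u\<bar>) \<partial>lborel) =
      ennreal (LINT u|lborel. \<bar>k u\<bar> * sqrt \<bar>e u - e' u\<bar>)"
    using integrable_abs[OF int] by (intro nn_integral_eq_integral) (auto simp: abs_mult)
  also have "\<dots>\<^sup>2 = ennreal ((LINT u|lborel. \<bar>k u\<bar> * sqrt \<bar>e u - e' u\<bar>)\<^sup>2)"
    by (simp add: ennreal_power)
  finally show ?thesis .
qed

lemma kernel_measurable [measurable]: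
  assumes [measurable]: "k \<in> borel_measurable borel" "e \<in> borel_measurable borel" "e' \<in> borel_measurable borel"
  shows "(\<lambda>x. LINT u|lborel. k u * (Z (e u) x - Z (e' u) x)) \<in> borel_measurable N"
  by measurable

lemma kernel_square_integrable:
  fixes k :: "real \<Rightarrow> real"
  assumes [measurable]: "k \<in> borel_measurable borel" "e \<in> borel_measurable borel" "e' \<in> borel_measurable borel"
    and int: "integrable lborel (\<lambda>u. k u * sqrt \<bar>e u - e' u\<bar>)"
  shows "square_integrable N (\<lambda>x. LINT u|lborel. k u * (Z (e u) x - Z (e' u) x))"
proof -
  have "(\<integral>\<^sup>+x. ennreal ((LINT u|lborel. k u * (Z (e u) x - Z (e' u) x))\<^sup>2) \<partial>N) < \<infinity>"
    using kernel_square_bound[OF assms] by (rule le_less_trans) simp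
  then show ?thesis
    unfolding square_integrable_def by (simp add: integrable_iff_bounded)
qed

end

section \<open>Discretisation along a grid\<close>

text \<open>Rounding down sends (0, 1/n) to 0, so the discretised increment vanishes where the
  kernel is singular. The cut-off at n leaves finitely many cells.\<close>

definition grid_floor :: "nat \<Rightarrow> real \<Rightarrow> real" where
  "grid_floor n u = (if 0 < u \<and> u < n then \<lfloor>n * u\<rfloor> / n else 0)"

lemma grid_floor_measurable [measurable]: "grid_floor n \<in> borel_measurable borel"
  unfolding grid_floor_def by measurable

lemma grid_floor_bounds:
  assumes "0 < u"
  shows "0 \<le> grid_floor n u" "grid_floor n u \<le> u"
  using assms by (auto simp: grid_floor_def field_simps)

lemma grid_floor_tendsto:
  assumes "0 < u"
  shows "(\<lambda>n. grid_floor n u) \<longlonglongrightarrow> u"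
proof -
  obtain N :: nat where N: "u < N" using reals_Archimedean2 by blast
  have "\<bar>grid_floor n u - u\<bar> \<le> 1 / n" if "n \<ge> N" for n
  proof -
    have n: "u < n" "0 < n" using N that assms by (auto intro: less_le_trans gr0I)
    have "u - grid_floor n u = (n * u - \<lfloor>n * u\<rfloor>) / n"
      using n assms by (simp add: grid_floor_def diff_divide_distrib)
    moreover have "\<dots> \<le> 1 / n" "0 \<le> \<dots>"
      using n divide_right_mono[of "n * u - \<lfloor>n * u\<rfloor>" 1 "real n"] by (linarith, simp)
    ultimately show ?thesis by (subst abs_minus_commute) (simp only: abs_of_nonneg)
  qed
  then have "(\<lambda>n. grid_floor n u - u) \<longlonglongrightarrow> 0"
    by (intro Lim_null_comparison[OF _ lim_1_over_n]) (auto simp: eventually_sequentially)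
  then show ?thesis by (rule LIM_zero_cancel)
qed

text \<open>Each coefficient is the mass of the kernel on one grid cell. Cell 0 is omitted: its
  increment is zero and the kernel need not be integrable on it. The bound n * n comes from u < n.
  The swap of endpoints with a sign change keeps the interval ordered when \<open>\<sigma>\<close>
  is negative.\<close>

definition kernel_steps :: "(real \<Rightarrow> real) \<Rightarrow> real \<Rightarrow> real \<Rightarrow> nat \<Rightarrow> step" where
  "kernel_steps k r \<sigma> n = map (\<lambda>j.
     let c = LINT u|lborel. k u * indicator {u. 0 < u \<and> u < n \<and> \<lfloor>n * u\<rfloor> = int j} u; u = r + \<sigma> * (j / n)
     in if r \<le> u then (c, r, u) else (- c, u, r)) [1..<n * n]"

lemma is_step_kernel_steps: "is_step (kernel_steps k r \<sigma> n)"
  by (auto simp: is_step_def kernel_steps_def Let_def)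

lemma step_integral_kernel_steps:
  assumes [measurable]: "k \<in> borel_measurable borel"
    and int: "integrable lborel (\<lambda>u. k u * sqrt \<bar>u\<bar>)"
  shows "step_integral Z (kernel_steps k r \<sigma> n) x =
    (LINT u|lborel. k u * (Z (r + \<sigma> * grid_floor n u) x - Z r x))"
proof -
  define C where "C j = {u :: real. 0 < u \<and> u < n \<and> \<lfloor>n * u\<rfloor> = int j}" for j
  have [measurable]: "C j \<in> sets borel" for j
    unfolding C_def by measurable
  \<comment> \<open>For j >= 1 the cell lies in u >= 1/n, where sqrt n * sqrt u >= 1, so the
    weighted integrability of k is enough.\<close>
  have kC: "integrable lborel (\<lambda>u. k u * indicator (C j) u)" if "1 \<le> j" for j
  proof (rule Bochner_Integration.integrable_bound)
    show "integrable lborel (\<lambda>u. sqrt n * (k u * sqrt \<bar>u\<bar>))"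
      using int by simp
    have "1 \<le> sqrt n * sqrt \<bar>u\<bar>" if "u \<in> C j" for u
    proof -
      have "1 \<le> \<lfloor>n * u\<rfloor>" "0 < u" using \<open>1 \<le> j\<close> that by (auto simp: C_def)
      then have "1 \<le> n * u" by linarith
      with \<open>0 < u\<close> show ?thesis by (simp flip: real_sqrt_mult)
    qed
    then have "\<bar>k u\<bar> * indicator (C j) u \<le> \<bar>k u\<bar> * (sqrt n * sqrt \<bar>u\<bar>)" for u
      by (intro mult_left_mono) (auto simp: indicator_def)
    then show "AE u in lborel. norm (k u * indicator (C j) u) \<le> norm (sqrt n * (k u * sqrt \<bar>u\<bar>))"
      by (simp add: abs_mult mult_ac)
  qed measurable
  have "step_integral Z (kernel_steps k r \<sigma> n) x =
      (\<Sum>j\<leftarrow>[1..<n * n]. (LINT u|lborel. k u * indicator (C j) u) * (Z (r + \<sigma> * (j / n)) x - Z r x))"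
    unfolding step_integral_def kernel_steps_def C_def map_map
    by (intro arg_cong[of _ _ sum_list] map_cong refl) (auto simp: Let_def algebra_simps)
  also have "\<dots> = (\<Sum>j\<in>{1..<n * n}. (LINT u|lborel. k u * indicator (C j) u) * (Z (r + \<sigma> * (j / n)) x - Z r x))"
    by (simp add: interv_sum_list_conv_sum_set_nat)
  also have "\<dots> = (\<Sum>j\<in>{1..<n * n}. LINT u|lborel. k u * indicator (C j) u * (Z (r + \<sigma> * (j / n)) x - Z r x))"
    by (intro sum.cong refl) simp
  also have "\<dots> = (LINT u|lborel. (\<Sum>j\<in>{1..<n * n}. k u * indicator (C j) u * (Z (r + \<sigma> * (j / n)) x - Z r x)))"
    by (rule Bochner_Integration.integral_sum[symmetric]) (auto intro!: integrable_mult_left kC)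
  also have "\<dots> = (LINT u|lborel. k u * (Z (r + \<sigma> * grid_floor n u) x - Z r x))"
  proof (rule Bochner_Integration.integral_cong[OF refl])
    fix u :: real
    show "(\<Sum>j\<in>{1..<n * n}. k u * indicator (C j) u * (Z (r + \<sigma> * (j / n)) x - Z r x)) =
        k u * (Z (r + \<sigma> * grid_floor n u) x - Z r x)"
    proof (cases "0 < u \<and> u < n")
      case True
      define i where "i = nat \<lfloor>n * u\<rfloor>"
      have "real n * u < real n * real n" using True by (intro mult_strict_left_mono) auto
      then have "\<lfloor>n * u\<rfloor> < int (n * n)" by (simp add: floor_less_iff)
      moreover have fl: "\<lfloor>n * u\<rfloor> = int i" using True by (simp add: i_def)
      ultimately have i: "i < n * n" by (simp only: of_nat_less_iff)
      have g: "grid_floor n u = i / n" using True fl by (simp add: grid_floor_def)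
      have "indicator (C j) u = (if j = i then 1 else (0::real))" for j
        using True fl by (auto simp: C_def)
      then have "(\<Sum>j\<in>{1..<n * n}. k u * indicator (C j) u * (Z (r + \<sigma> * (j / n)) x - Z r x)) =
          (\<Sum>j\<in>{1..<n * n}. if j = i then k u * (Z (r + \<sigma> * (j / n)) x - Z r x) else 0)"
        by (intro sum.cong) auto
      \<comment> \<open>For i = 0 the sum has no matching term, and the right-hand side is zero as
        well because the increment is.\<close>
      also have "\<dots> = k u * (Z (r + \<sigma> * (i / n)) x - Z r x)"
        using i by (cases "i = 0") auto
      finally show ?thesis by (simp add: g)
    next
      case False
      then have "u \<notin> C j" for j by (auto simp: C_def)
      then show ?thesis using False by (auto simp: grid_floor_def)
    qed
  qed
  finally show ?thesis .
qed

lemma (in measurable_linear_variogram) kernel_steps_L2_limit: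
  assumes k [measurable]: "k \<in> borel_measurable borel"
    and k0: "\<And>u. u \<le> 0 \<Longrightarrow> k u = 0"
    and int: "integrable lborel (\<lambda>u. k u * sqrt \<bar>u\<bar>)"
    and \<sigma>: "\<bar>\<sigma>\<bar> = 1"
  shows "(\<lambda>n. LINT x|N. (step_integral Z (kernel_steps k r \<sigma> n) x
      - (LINT u|lborel. k u * (Z (r + \<sigma> * u) x - Z r x)))\<^sup>2) \<longlonglongrightarrow> 0"
proof (rule tendsto_sandwich[OF _ _ tendsto_const])
  let ?e = "\<lambda>n. LINT u|lborel. \<bar>k u\<bar> * sqrt \<bar>grid_floor n u - u\<bar>"
  have dist: "\<bar>(r + \<sigma> * a) - (r + \<sigma> * b)\<bar> = \<bar>a - b\<bar>" for a b
    using \<sigma> by (simp add: abs_mult flip: right_diff_distrib)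
  have bnd: "\<bar>k u\<bar> * sqrt \<bar>grid_floor n u - u\<bar> \<le> \<bar>k u\<bar> * sqrt \<bar>u\<bar>"
    "\<bar>k u\<bar> * sqrt \<bar>grid_floor n u\<bar> \<le> \<bar>k u\<bar> * sqrt \<bar>u\<bar>" for n u
    using grid_floor_bounds[of u n] k0[of u]
    by (cases "0 < u"; auto intro!: mult_left_mono)+
  have int1: "integrable lborel (\<lambda>u. k u * sqrt \<bar>grid_floor n u - u\<bar>)" for n
    by (rule Bochner_Integration.integrable_bound[OF int]) (auto simp: abs_mult bnd)
  have int2: "integrable lborel (\<lambda>u. k u * sqrt \<bar>grid_floor n u\<bar>)" for n
    by (rule Bochner_Integration.integrable_bound[OF int]) (auto simp: abs_mult bnd)
  have "?e \<longlonglongrightarrow> (LINT u::real|lborel. (0::real))"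
  proof (rule integral_dominated_convergence)
    show "integrable lborel (\<lambda>u. \<bar>k u\<bar> * sqrt \<bar>u\<bar>)"
      using integrable_abs[OF int] by (simp add: abs_mult)
    have "(\<lambda>n. \<bar>k u\<bar> * sqrt \<bar>grid_floor n u - u\<bar>) \<longlonglongrightarrow> 0" for u
    proof (cases "0 < u")
      case True
      have "(\<lambda>n. \<bar>k u\<bar> * sqrt \<bar>grid_floor n u - u\<bar>) \<longlonglongrightarrow> \<bar>k u\<bar> * sqrt \<bar>u - u\<bar>"
        by (intro tendsto_intros grid_floor_tendsto True)
      then show ?thesis by simp
    qed (simp add: k0)
    then show "AE u in lborel. (\<lambda>n. \<bar>k u\<bar> * sqrt \<bar>grid_floor n u - u\<bar>) \<longlonglongrightarrow> 0" by simp
  qed (auto simp: bnd abs_mult)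
  then have "?e \<longlonglongrightarrow> 0" by simp
  from tendsto_power[OF this, of 2]
  show "(\<lambda>n. (?e n)\<^sup>2) \<longlonglongrightarrow> 0" by simp
  have le: "(LINT x|N. (step_integral Z (kernel_steps k r \<sigma> n) x
      - (LINT u|lborel. k u * (Z (r + \<sigma> * u) x - Z r x)))\<^sup>2) \<le> (?e n)\<^sup>2" for n
  proof -
    \<comment> \<open>Almost sure integrability of both integrands is what permits merging the two
      integrals into one.\<close>
    have "AE x in N. integrable lborel (\<lambda>u. k u * (Z (r + \<sigma> * grid_floor n u) x - Z r x))"
      by (rule kernel_integrable_AE) (use int2 \<sigma> in \<open>simp_all add: abs_mult\<close>)
    moreover have "AE x in N. integrable lborel (\<lambda>u. k u * (Z (r + \<sigma> * u) x - Z r x))"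
      by (rule kernel_integrable_AE) (use int \<sigma> in \<open>simp_all add: abs_mult\<close>)
    ultimately have "AE x in N. (step_integral Z (kernel_steps k r \<sigma> n) x
        - (LINT u|lborel. k u * (Z (r + \<sigma> * u) x - Z r x)))\<^sup>2 =
        (LINT u|lborel. k u * (Z (r + \<sigma> * grid_floor n u) x - Z (r + \<sigma> * u) x))\<^sup>2"
    proof eventually_elim
      case (elim x)
      show ?case
        unfolding step_integral_kernel_steps[OF k int]
        by (subst Bochner_Integration.integral_diff[OF elim, symmetric]) (simp add: right_diff_distrib)
    qed
    then have "(LINT x|N. (step_integral Z (kernel_steps k r \<sigma> n) x
        - (LINT u|lborel. k u * (Z (r + \<sigma> * u) x - Z r x)))\<^sup>2) =
        (LINT x|N. (LINT u|lborel. k u * (Z (r + \<sigma> * grid_floor n u) x - Z (r + \<sigma> * u) x))\<^sup>2)"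
      by (intro integral_cong_AE) measurable
    also have "\<dots> = enn2real (\<integral>\<^sup>+x. ennreal ((LINT u|lborel. k u * (Z (r + \<sigma> * grid_floor n u) x - Z (r + \<sigma> * u) x))\<^sup>2) \<partial>N)"
      by (rule integral_eq_nn_integral) auto
    also have "\<dots> \<le> (?e n)\<^sup>2"
    proof (rule enn2real_leI)
      show "(\<integral>\<^sup>+x. ennreal ((LINT u|lborel. k u * (Z (r + \<sigma> * grid_floor n u) x - Z (r + \<sigma> * u) x))\<^sup>2) \<partial>N)
          \<le> ennreal ((?e n)\<^sup>2)"
        using kernel_square_bound[of k "\<lambda>u. r + \<sigma> * grid_floor n u" "\<lambda>u. r + \<sigma> * u"] int1[of n]
        by (simp only: dist) simp
    qed simp
    finally show ?thesis .
  qed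
  show "\<forall>\<^sub>F n in sequentially. (LINT x|N. (step_integral Z (kernel_steps k r \<sigma> n) x
      - (LINT u|lborel. k u * (Z (r + \<sigma> * u) x - Z r x)))\<^sup>2) \<le> (?e n)\<^sup>2"
    using le by simp
qed simp

interpretation heaviside: measurable_linear_variogram lborel heaviside
  by unfold_locales (use heaviside_measurable in \<open>simp cong: measurable_cong_sets sets_pair_measure_cong\<close>)

text \<open>In effect a stochastic Fubini theorem: integration against k commutes with the Wiener
  integral. The same lists \<open>kernel_steps k r \<sigma> n\<close> approximate on both
  sides.\<close>

lemma (in measurable_linear_variogram) has_wiener_integral_kernel:
  assumes k[measurable]: "k \<in> borel_measurable borel"
    and k0: "\<And>u. u \<le> 0 \<Longrightarrow> k u = 0"
    and int: "integrable lborel (\<lambda>u. k u * sqrt \<bar>u\<bar>)"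
    and \<sigma>: "\<bar>\<sigma>\<bar> = 1"
  shows "has_wiener_integral N Z
    (\<lambda>s. LINT u|lborel. k u * (heaviside (r + \<sigma> * u) s - heaviside r s))
    (\<lambda>x. LINT u|lborel. k u * (Z (r + \<sigma> * u) x - Z r x))"
proof -
  have int': "integrable lborel (\<lambda>u. k u * sqrt \<bar>(r + \<sigma> * u) - r\<bar>)"
    using int \<sigma> by (simp add: abs_mult)
  have "step_fun (kernel_steps k r \<sigma> n) s = step_integral heaviside (kernel_steps k r \<sigma> n) s" for n s
    by (rule step_fun_eq_step_integral[OF is_step_kernel_steps])
  then have "(\<lambda>n. LINT s|lborel. (step_fun (kernel_steps k r \<sigma> n) s -
      (LINT u|lborel. k u * (heaviside (r + \<sigma> * u) s - heaviside r s)))\<^sup>2) \<longlonglongrightarrow> 0"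
    using heaviside.kernel_steps_L2_limit[OF assms, of r] by simp
  moreover have "square_integrable lborel (\<lambda>s. LINT u|lborel. k u * (heaviside (r + \<sigma> * u) s - heaviside r s))"
    by (rule heaviside.kernel_square_integrable) (use int' in auto)
  moreover have "square_integrable N (\<lambda>x. LINT u|lborel. k u * (Z (r + \<sigma> * u) x - Z r x))"
    by (rule kernel_square_integrable) (use int' in auto)
  moreover note kernel_steps_L2_limit[OF assms, of r] is_step_kernel_steps[of k r \<sigma>]
  ultimately show ?thesis
    unfolding has_wiener_integral_def by (intro conjI exI[of _ "kernel_steps k r \<sigma>"] allI)
qed

subsection \<open>Hoelder continuity and growth of Brownian paths\<close>

text \<open>The dyadic approximants \<open>a n x\<close> below telescope to \<open>f x\<close>, and two points at distance at most
  \<open>1 / 2 ^ n\<close> lie in equal or adjacent dyadic intervals of level \<open>n\<close>.\<close>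

lemma dyadic_increments_imp_Hoelder:
  fixes f :: "real \<Rightarrow> real"
  assumes cont: "continuous_on {0..1} f" and g: "0 < \<gamma>" and K: "0 \<le> K"
    and inc: "\<And>n i. i < 2 ^ n \<Longrightarrow> \<bar>f (real (Suc i) / 2 ^ n) - f (real i / 2 ^ n)\<bar> \<le> K * (2 powr - \<gamma>) ^ n"
    and x: "x \<in> {0..1}" and y: "y \<in> {0..1}"
  shows "\<bar>f x - f y\<bar> \<le> (1 + 2 / (1 - 2 powr - \<gamma>)) * 2 powr \<gamma> * K * \<bar>x - y\<bar> powr \<gamma>"
proof -
  define q where "q = (2::real) powr - \<gamma>"
  have q: "0 < q" "q < 1" using g by (auto simp: q_def powr_minus_divide)
  define a where "a n z = f (\<lfloor>2 ^ n * z\<rfloor> / 2 ^ n)" for n and z :: real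
  have inc': "\<bar>f ((of_int i + 1) / 2 ^ n) - f (of_int i / 2 ^ n)\<bar> \<le> K * q ^ n"
    if "0 \<le> i" "i < 2 ^ n" for i :: int and n
  proof -
    obtain j where "i = int j" using \<open>0 \<le> i\<close> nonneg_int_cases by blast
    with that inc[of j n] show ?thesis
      by (simp add: q_def add.commute)
  qed
  have step: "\<bar>a (Suc n) z - a n z\<bar> \<le> K * q ^ Suc n" if z: "z \<in> {0..1}" for n z
  proof -
    define i where "i = \<lfloor>2 ^ n * z\<rfloor>"
    have i: "0 \<le> i" using z by (simp add: i_def)
    have an: "a n z = f (of_int (2 * i) / 2 ^ Suc n)"
      by (simp add: a_def i_def)
    have "of_int i \<le> 2 ^ n * z" "2 ^ n * z < of_int i + 1" by (auto simp: i_def)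
    then have "of_int (2 * i) \<le> 2 ^ Suc n * z" "2 ^ Suc n * z < of_int (2 * i) + 2" by auto
    then have "\<lfloor>2 ^ Suc n * z\<rfloor> = 2 * i \<or> \<lfloor>2 ^ Suc n * z\<rfloor> = 2 * i + 1" by linarith
    then show ?thesis
    proof
      assume "\<lfloor>2 ^ Suc n * z\<rfloor> = 2 * i"
      then show ?thesis using K q unfolding an by (simp add: a_def)
    next
      \<comment> \<open>Here the difference is the increment of level \<open>Suc n\<close> starting
        at 2 * i. From z <= 1 one gets 2 * i < 2 ^ Suc n, as \<open>inc'\<close> demands; z = 1
        itself always falls under the even case.\<close>
      assume *: "\<lfloor>2 ^ Suc n * z\<rfloor> = 2 * i + 1"
      have "2 ^ Suc n * z \<le> 2 ^ Suc n * 1" using z by (intro mult_left_mono) auto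
      from order_trans[OF of_int_floor_le this]
      have "real_of_int \<lfloor>2 ^ Suc n * z\<rfloor> \<le> real_of_int (2 ^ Suc n)"
        unfolding of_int_power of_int_numeral mult_1_right .
      then have "\<lfloor>2 ^ Suc n * z\<rfloor> \<le> 2 ^ Suc n" by (simp only: of_int_le_iff)
      with * have "2 * i + 1 \<le> 2 ^ Suc n" by simp
      then have "2 * i < 2 ^ Suc n" by simp
      from inc'[OF _ this] i show ?thesis
        unfolding an using * by (simp add: a_def)
    qed
  qed
  have tail: "\<bar>a (n + m) z - a n z\<bar> \<le> K * q ^ n * (1 / (1 - q))" if z: "z \<in> {0..1}" for n m z
  proof -
    have "\<bar>a (n + m) z - a n z\<bar> \<le> (\<Sum>j<m. K * q ^ Suc (n + j))"
    proof (induction m)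
      case (Suc m)
      from step[OF z, of "n + m"] Suc.IH show ?case by simp
    qed simp
    also have "\<dots> = K * q ^ n * (q * (\<Sum>j<m. q ^ j))"
      by (simp add: sum_distrib_left power_add mult_ac)
    also have "\<dots> \<le> K * q ^ n * (1 * (1 / (1 - q)))"
    proof (intro mult_left_mono mult_mono)
      have "(\<Sum>j<m. q ^ j) = (1 - q ^ m) / (1 - q)"
        using q by (simp add: sum_gp_strict)
      also have "\<dots> \<le> 1 / (1 - q)" using q by (intro divide_right_mono) auto
      finally show "(\<Sum>j<m. q ^ j) \<le> 1 / (1 - q)" .
    qed (use q K in \<open>auto intro!: sum_nonneg\<close>)
    finally show ?thesis by simp
  qed
  have lim: "(\<lambda>m. a (n + m) z) \<longlonglongrightarrow> f z" if z: "z \<in> {0..1}" for n z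
  proof -
    have "(\<lambda>m. \<lfloor>2 ^ m * z\<rfloor> / 2 ^ m) \<longlonglongrightarrow> z"
    proof (rule LIM_zero_cancel, rule Lim_null_comparison)
      have "\<bar>\<lfloor>2 ^ m * z\<rfloor> / 2 ^ m - z\<bar> \<le> (1 / 2) ^ m" for m
      proof -
        have "\<lfloor>2 ^ m * z\<rfloor> / 2 ^ m - z = (\<lfloor>2 ^ m * z\<rfloor> - 2 ^ m * z) / 2 ^ m"
          by (simp add: diff_divide_distrib)
        then have "\<bar>\<lfloor>2 ^ m * z\<rfloor> / 2 ^ m - z\<bar> = \<bar>\<lfloor>2 ^ m * z\<rfloor> - 2 ^ m * z\<bar> / 2 ^ m"
          by (simp add: abs_divide)
        also have "\<dots> \<le> 1 / 2 ^ m"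
          by (intro divide_right_mono) (linarith, simp)
        finally show ?thesis by (simp add: power_divide)
      qed
      then show "\<forall>\<^sub>F m in sequentially. norm (\<lfloor>2 ^ m * z\<rfloor> / 2 ^ m - z) \<le> (1 / 2) ^ m" by simp
      show "(\<lambda>m. (1 / 2 :: real) ^ m) \<longlonglongrightarrow> 0" by (intro LIMSEQ_power_zero) auto
    qed
    moreover have "\<lfloor>2 ^ m * z\<rfloor> / 2 ^ m \<in> {0..1}" for m
    proof -
      have "\<lfloor>2 ^ m * z\<rfloor> \<le> 2 ^ m * z" by simp
      also have "\<dots> \<le> 2 ^ m * 1" using z by (intro mult_left_mono) auto
      finally have "real_of_int \<lfloor>2 ^ m * z\<rfloor> \<le> 2 ^ m" by simp
      moreover have "0 \<le> \<lfloor>2 ^ m * z\<rfloor>" using z by simp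
      ultimately show ?thesis by (simp add: divide_le_eq)
    qed
    ultimately have "(\<lambda>m. f (\<lfloor>2 ^ m * z\<rfloor> / 2 ^ m)) \<longlonglongrightarrow> f z"
      using cont z by (intro continuous_on_tendsto_compose[OF cont]) auto
    then have "(\<lambda>m. a m z) \<longlonglongrightarrow> f z" by (simp add: a_def)
    from LIMSEQ_ignore_initial_segment[OF this, of n] show ?thesis by (simp add: add.commute)
  qed
  have approx: "\<bar>f z - a n z\<bar> \<le> K * q ^ n * (1 / (1 - q))" if z: "z \<in> {0..1}" for n z
  proof (rule LIMSEQ_le_const2)
    show "(\<lambda>m. \<bar>a (n + m) z - a n z\<bar>) \<longlonglongrightarrow> \<bar>f z - a n z\<bar>"
      by (intro tendsto_intros lim z)
    show "\<exists>N. \<forall>m\<ge>N. \<bar>a (n + m) z - a n z\<bar> \<le> K * q ^ n * (1 / (1 - q))"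
      using tail[OF z] by blast
  qed
  have main: "\<bar>f x - f y\<bar> \<le> (1 + 2 / (1 - q)) * 2 powr \<gamma> * K * (y - x) powr \<gamma>"
    if x: "x \<in> {0..1}" and y: "y \<in> {0..1}" and less: "x < y" for x y
  proof -
    have "y - x \<le> 1" using x y by auto
    have "\<exists>n. (1 / 2) ^ n < y - x"
      using less by (intro real_arch_pow_inv) auto
    \<comment> \<open>Minimality gives y - x <= 2^(-n) for the preceding level n = N - 1, while
      2^(-N) < y - x. The factor \<open>2 powr \<gamma>\<close> in the constant pays for this shift
      by one level.\<close>
    define N where "N = (LEAST n. (1 / 2 :: real) ^ n < y - x)"
    have N: "(1 / 2) ^ N < y - x" unfolding N_def by (rule LeastI_ex) fact
    have "N \<noteq> 0" using N \<open>y - x \<le> 1\<close> by (cases "N = 0") auto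
    then obtain n where n: "N = Suc n" by (cases N) auto
    have up: "y - x \<le> (1 / 2) ^ n"
      using not_less_Least[of n "\<lambda>n. (1 / 2 :: real) ^ n < y - x"] n unfolding N_def[symmetric] by simp
    define i j where "i = \<lfloor>2 ^ n * x\<rfloor>" and "j = \<lfloor>2 ^ n * y\<rfloor>"
    have "2 ^ n * y - 2 ^ n * x \<le> 2 ^ n * (1 / 2) ^ n"
      using up by (simp flip: right_diff_distrib)
    then have "2 ^ n * y \<le> 2 ^ n * x + 1" by (simp add: power_divide)
    moreover have "2 ^ n * x \<le> 2 ^ n * y" using less by simp
    ultimately have ij: "j = i \<or> j = i + 1"
      unfolding i_def j_def by linarith
    have "0 \<le> i" using x by (simp add: i_def)
    have "2 ^ n * y \<le> 2 ^ n * 1" using y by (intro mult_left_mono) auto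
    from order_trans[OF of_int_floor_le this]
    have "real_of_int j \<le> real_of_int (2 ^ n)"
      unfolding j_def of_int_power of_int_numeral mult_1_right .
    then have "j \<le> 2 ^ n" by (simp only: of_int_le_iff)
    have "\<bar>a n y - a n x\<bar> \<le> K * q ^ n"
      using ij
    proof
      assume "j = i + 1"
      then show ?thesis using inc'[of i n] \<open>0 \<le> i\<close> \<open>j \<le> 2 ^ n\<close>
        by (simp add: a_def flip: i_def j_def)
    qed (use K q in \<open>simp add: a_def flip: i_def j_def\<close>)
    \<comment> \<open>The constant 1 + 2 / (1 - q) collects one increment of level n and the
      geometric tails at x and at y.\<close>
    with approx[OF x, of n] approx[OF y, of n]
    have "\<bar>f x - f y\<bar> \<le> K * q ^ n + 2 * (K * q ^ n * (1 / (1 - q)))" by argo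
    also have "\<dots> = (1 + 2 / (1 - q)) * K * q ^ n" by (simp add: algebra_simps)
    also have "q ^ n = 2 powr \<gamma> * ((1 / 2) ^ N) powr \<gamma>"
    proof -
      have "q ^ n = 2 powr (- \<gamma> * n)" by (simp add: q_def powr_powr flip: powr_realpow)
      also have "\<dots> = 2 powr (\<gamma> + - real N * \<gamma>)" by (simp add: n algebra_simps)
      also have "\<dots> = 2 powr \<gamma> * (2 powr (- real N)) powr \<gamma>" by (simp add: powr_powr flip: powr_add)
      also have "2 powr (- real N) = (1 / 2) ^ N"
        by (simp add: powr_minus powr_realpow power_divide inverse_eq_divide)
      finally show ?thesis .
    qed
    also have "(1 + 2 / (1 - q)) * K * (2 powr \<gamma> * ((1 / 2) ^ N) powr \<gamma>) \<le>
        (1 + 2 / (1 - q)) * K * (2 powr \<gamma> * (y - x) powr \<gamma>)"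
      using N g K q by (intro mult_left_mono powr_mono2) auto
    finally show ?thesis by (simp add: mult_ac)
  qed
  consider "x < y" | "x = y" | "y < x" by linarith
  then show ?thesis
  proof cases
    case 1
    then show ?thesis using main[OF x y 1] by (simp add: q_def)
  next
    case 3
    then show ?thesis using main[OF y x 3] by (simp add: q_def abs_minus_commute)
  qed simp
qed

section \<open>From Gaussian moments to path regularity\<close>

text \<open>One constant for all R combines local regularity with growth: for |x - y| comparable to
  R the bound is of order R^(1/2 + 1/m). Letting m run through the naturals approaches exponent 1/2
  from both sides with countably many almost sure events.\<close>

definition Hoelder_growth :: "(real \<Rightarrow> real) \<Rightarrow> bool" where
  "Hoelder_growth b \<longleftrightarrow> continuous_on UNIV b \<and>
     (\<forall>m. (3::nat) \<le> m \<longrightarrow> (\<exists>C\<ge>0. \<forall>R\<ge>1. \<forall>x\<in>{- R..R}. \<forall>y\<in>{- R..R}.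
        \<bar>b x - b y\<bar> \<le> C * R powr (2 / m) * \<bar>x - y\<bar> powr (1/2 - 1 / m)))"

text \<open>Even moments of a centred Gaussian. The case m = 1 is the linear variogram; m >= 3 is
  used for path regularity.\<close>

lemma two_sided_BM_moment:
  assumes BM: "two_sided_BM M B"
  shows "(\<integral>\<^sup>+\<omega>. ennreal ((B t \<omega> - B s \<omega>) ^ (2 * m)) \<partial>M) =
    ennreal (fact (2 * m) / (2 ^ m * fact m) * \<bar>t - s\<bar> ^ m)"
proof -
  interpret prob_space M using BM by (simp add: two_sided_BM_def)
  have *: "(\<integral>\<^sup>+\<omega>. ennreal ((B t \<omega> - B s \<omega>) ^ (2 * m)) \<partial>M) =
      ennreal (fact (2 * m) / (2 ^ m * fact m) * \<bar>t - s\<bar> ^ m)" if "s < t" for s t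
  proof -
    have "distributed M lborel (\<lambda>\<omega>. B t \<omega> - B s \<omega>) (\<lambda>x. ennreal (normal_density 0 (sqrt (t - s)) x))"
      using BM that by (simp add: two_sided_BM_def)
    from distributed_nn_integral[OF this, of "\<lambda>x. ennreal (x ^ (2 * m))"]
    have "(\<integral>\<^sup>+\<omega>. ennreal ((B t \<omega> - B s \<omega>) ^ (2 * m)) \<partial>M) =
        (\<integral>\<^sup>+x. ennreal (normal_density 0 (sqrt (t - s)) x) * ennreal (x ^ (2 * m)) \<partial>lborel)"
      by simp
    also have "\<dots> = (\<integral>\<^sup>+x. ennreal (normal_density 0 (sqrt (t - s)) x * (x - 0) ^ (2 * m)) \<partial>lborel)"
      by (intro nn_integral_cong) (simp add: ennreal_mult zero_le_even_power)
    also have "\<dots> = ennreal (fact (2 * m) / ((2 / (sqrt (t - s))\<^sup>2) ^ m * fact m))"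
    proof -
      have "integrable lborel (\<lambda>x. normal_density 0 (sqrt (t - s)) x * (x - 0) ^ (2 * m))"
        "(LINT x|lborel. normal_density 0 (sqrt (t - s)) x * (x - 0) ^ (2 * m)) =
          fact (2 * m) / ((2 / (sqrt (t - s))\<^sup>2) ^ m * fact m)"
        using normal_moment_even[where \<mu> = 0 and \<sigma> = "sqrt (t - s)" and k = m] that unfolding has_bochner_integral_iff by simp_all
      then show ?thesis
        by (subst nn_integral_eq_integral) (auto simp: zero_le_even_power)
    qed
    also have "(sqrt (t - s))\<^sup>2 = \<bar>t - s\<bar>" using that by simp
    also have "fact (2 * m) / ((2 / \<bar>t - s\<bar>) ^ m * fact m) = fact (2 * m) / (2 ^ m * fact m) * \<bar>t - s\<bar> ^ m"
      by (simp add: power_divide)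
    finally show ?thesis .
  qed
  consider "s < t" | "s = t" | "t < s" by linarith
  then show ?thesis
  proof cases
    case 1
    then show ?thesis by (rule *)
  next
    case 2
    then show ?thesis by (cases m) (auto simp: emeasure_space_1)
  next
    case 3
    have "(B t \<omega> - B s \<omega>) ^ (2 * m) = (B s \<omega> - B t \<omega>) ^ (2 * m)" for \<omega>
      by (simp add: power_mult power2_commute)
    then show ?thesis using *[OF 3] by (simp add: abs_minus_commute)
  qed
qed

text \<open>The image of i / 2^n under the affine map of [0, 1] onto [-2^p, 2^p].\<close>

definition dyadic_point :: "nat \<Rightarrow> nat \<Rightarrow> nat \<Rightarrow> real" where
  "dyadic_point p n i = - (2 ^ p) + 2 ^ Suc p * (i / 2 ^ n)"

text \<open>The weights make the expected sum over all scales \<open>p\<close> and levels \<open>n\<close> a convergent geometric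
  series: level \<open>n\<close> has \<open>2 ^ n\<close> increments, with moment of order \<open>2 m\<close> proportional to
  \<open>(2 ^ p / 2 ^ n) ^ m\<close>.\<close>

lemma AE_dyadic_increments:
  assumes BM: "two_sided_BM M B" and m: "3 \<le> m"
  shows "AE \<omega> in M. \<exists>S\<ge>0. \<forall>p n. \<forall>i<2 ^ n.
    (B (dyadic_point p n (Suc i)) \<omega> - B (dyadic_point p n i) \<omega>) ^ (2 * m) \<le> S * 2 ^ (p * (m + 1)) / 2 ^ (n * (m - 2))"
proof -
  have [measurable]: "B t \<in> borel_measurable M" for t
    using BM by (simp add: two_sided_BM_def)
  define D where "D p n i \<omega> = (1/2) ^ (p * (m + 1)) * 2 ^ (n * (m - 2)) *
    (B (dyadic_point p n (Suc i)) \<omega> - B (dyadic_point p n i) \<omega>) ^ (2 * m)" for p n i \<omega>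
  have [measurable]: "D p n i \<in> borel_measurable M" for p n i
    unfolding D_def by measurable
  have D0: "0 \<le> D p n i \<omega>" for p n i \<omega>
    by (simp add: D_def zero_le_even_power)
  \<comment> \<open>The extra factor 2 ^ m stems from the length 2 ^ Suc p of the interval at scale
    p.\<close>
  define c :: real where "c = fact (2 * m) / (2 ^ m * fact m) * 2 ^ m"
  have "c \<ge> 0" by (simp add: c_def)
  \<comment> \<open>Summed over the 2^n increments of level n this becomes c 2^(-p) 2^(-n), which is
    what the exponents in \<open>D\<close> are chosen for.\<close>
  have ED: "(\<integral>\<^sup>+\<omega>. ennreal (D p n i \<omega>) \<partial>M) = ennreal (c * (1/2) ^ p * (1/2) ^ n / 2 ^ n)" for p n i
  proof -
    have dist: "\<bar>dyadic_point p n (Suc i) - dyadic_point p n i\<bar> = 2 ^ Suc p / 2 ^ n"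
      by (simp add: dyadic_point_def field_simps)
    have "(\<integral>\<^sup>+\<omega>. ennreal (D p n i \<omega>) \<partial>M) = ennreal ((1/2) ^ (p * (m + 1)) * 2 ^ (n * (m - 2))) *
       (\<integral>\<^sup>+\<omega>. ennreal ((B (dyadic_point p n (Suc i)) \<omega> - B (dyadic_point p n i) \<omega>) ^ (2 * m)) \<partial>M)"
      unfolding D_def by (subst nn_integral_cmult[symmetric]) (auto simp: ennreal_mult zero_le_even_power)
    also have "\<dots> = ennreal ((1/2) ^ (p * (m + 1)) * 2 ^ (n * (m - 2)) *
        (fact (2 * m) / (2 ^ m * fact m) * (2 ^ Suc p / 2 ^ n) ^ m))"
      unfolding two_sided_BM_moment[OF BM] dist by (rule ennreal_mult[symmetric]) auto
    also have "(1/2) ^ (p * (m + 1)) * 2 ^ (n * (m - 2)) * (fact (2 * m) / (2 ^ m * fact m) * (2 ^ Suc p / 2 ^ n) ^ m) =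
        c * (1/2) ^ p * (1/2) ^ n / (2 ^ n :: real)"
    proof -
      define l where "l = m - 2"
      with m have l: "m = l + 2" by simp
      define X Y :: real where "X = 2 ^ p" and "Y = 2 ^ n"
      have XY: "X > 0" "Y > 0" by (simp_all add: X_def Y_def)
      have 1: "(1/2) ^ (p * (m + 1)) = 1 / (X ^ m * X)"
        by (simp add: X_def power_divide power_mult power_add)
      have 2: "2 ^ (n * (m - 2)) = Y ^ l"
        by (simp add: Y_def l power_mult)
      have 3: "(2 ^ Suc p / Y) ^ m = 2 ^ m * X ^ m / (Y ^ l * Y * Y)"
        unfolding X_def Y_def power_Suc
        by (simp add: l power_divide power_mult_distrib power_add power2_eq_square mult_ac)
      have 4: "(1/2) ^ p = 1 / X" "(1/2) ^ n = 1 / Y"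
        by (simp_all add: X_def Y_def power_divide)
      have alg: "1 / (U * X) * V * (F * (A * U / (V * Y * Y))) = F * A * (1 / X) * (1 / Y) / Y"
        if "U > 0" "V > 0" for U V F A :: real
        using that XY by (simp add: field_simps)
      show ?thesis
        unfolding c_def Y_def[symmetric] 1 2 3 4 using XY by (intro alg) auto
    qed
    finally show ?thesis .
  qed
  define S where "S \<omega> = (\<Sum>p. \<Sum>n. \<Sum>i<2 ^ n. ennreal (D p n i \<omega>))" for \<omega>
  have "(\<integral>\<^sup>+\<omega>. S \<omega> \<partial>M) = (\<Sum>p. \<Sum>n. \<Sum>i<2 ^ n. (\<integral>\<^sup>+\<omega>. ennreal (D p n i \<omega>) \<partial>M))"
    unfolding S_def by (simp add: nn_integral_suminf nn_integral_sum)
  also have "\<dots> = (\<Sum>p. \<Sum>n. ennreal (c * (1/2) ^ p * (1/2) ^ n))"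
    unfolding ED using \<open>c \<ge> 0\<close> by (simp add: ennreal_of_nat_eq_real_of_nat flip: ennreal_mult)
  also have "\<dots> = (\<Sum>p. ennreal (c * (1/2) ^ p * 2))"
  proof (intro suminf_cong suminf_ennreal_eq)
    show "(\<lambda>n. c * (1/2) ^ p * (1/2) ^ n) sums (c * (1/2) ^ p * 2)" for p
      using sums_mult[OF geometric_sums[of "1/2 :: real"], of "c * (1/2) ^ p"] by simp
  qed (use \<open>c \<ge> 0\<close> in auto)
  also have "\<dots> = ennreal (c * 2 * 2)"
  proof (rule suminf_ennreal_eq)
    show "(\<lambda>p. c * (1/2) ^ p * 2) sums (c * 2 * 2)"
      using sums_mult[OF geometric_sums[of "1/2 :: real"], of "c * 2"] by (simp add: mult_ac)
  qed (use \<open>c \<ge> 0\<close> in auto)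
  finally have "(\<integral>\<^sup>+\<omega>. S \<omega> \<partial>M) \<noteq> \<infinity>" by simp
  then have "AE \<omega> in M. S \<omega> \<noteq> \<infinity>"
    by (intro nn_integral_noteq_infinite) (auto simp: S_def)
  then show ?thesis
  proof eventually_elim
    case (elim \<omega>)
    then obtain s where s: "S \<omega> = ennreal s" "0 \<le> s" by (cases "S \<omega>") auto
    \<comment> \<open>A finite sum of nonnegative terms bounds each of them, uniformly in p, n and
      i; this takes the place of Chebyshev with Borel-Cantelli.\<close>
    have le: "D p n i \<omega> \<le> s" if "i < 2 ^ n" for p n i
    proof -
      have "ennreal (D p n i \<omega>) \<le> (\<Sum>i<2 ^ n. ennreal (D p n i \<omega>))"
        using that by (intro member_le_sum) auto
      also have "\<dots> \<le> (\<Sum>n. \<Sum>i<2 ^ n. ennreal (D p n i \<omega>))"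
        using sum_le_suminf[of "\<lambda>n. \<Sum>i<2 ^ n. ennreal (D p n i \<omega>)" "{n}"] by simp
      also have "\<dots> \<le> S \<omega>"
        using sum_le_suminf[of "\<lambda>p. \<Sum>n. \<Sum>i<2 ^ n. ennreal (D p n i \<omega>)" "{p}"] by (simp add: S_def)
      finally show ?thesis using s by simp
    qed
    show ?case
    proof (intro exI[of _ s] conjI allI impI s)
      fix p n i :: nat assume "i < 2 ^ n"
      from le[OF this, of p] show "(B (dyadic_point p n (Suc i)) \<omega> - B (dyadic_point p n i) \<omega>) ^ (2 * m) \<le>
          s * 2 ^ (p * (m + 1)) / 2 ^ (n * (m - 2))"
        unfolding D_def by (simp add: field_simps power_divide)
    qed
  qed
qed

lemma le_of_even_power_le:
  fixes x y :: real
  assumes "x ^ (2 * m) \<le> y" "0 < m" "0 \<le> y"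
  shows "\<bar>x\<bar> \<le> y powr (1 / real (2 * m))"
proof -
  have "\<bar>x\<bar> = (x ^ (2 * m)) powr (1 / real (2 * m))"
  proof (cases "x = 0")
    case False
    have "x ^ (2 * m) = \<bar>x\<bar> powr (2 * m)"
      using False by (subst powr_realpow) (auto simp: power_even_abs)
    then show ?thesis using assms(2) by (simp add: powr_powr)
  qed (use assms in auto)
  also have "\<dots> \<le> y powr (1 / real (2 * m))"
    using assms by (intro powr_mono2) (auto simp: zero_le_even_power)
  finally show ?thesis .
qed

theorem two_sided_BM_Hoelder_growth:
  assumes BM: "two_sided_BM M B"
  shows "AE \<omega> in M. Hoelder_growth (\<lambda>t. B t \<omega>)"
proof -
  have "AE \<omega> in M. \<forall>m::nat. 3 \<le> m \<longrightarrow> (\<exists>S\<ge>0. \<forall>p n. \<forall>i<2 ^ n.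
      (B (dyadic_point p n (Suc i)) \<omega> - B (dyadic_point p n i) \<omega>) ^ (2 * m) \<le> S * 2 ^ (p * (m + 1)) / 2 ^ (n * (m - 2)))"
    using AE_dyadic_increments[OF BM] by (simp add: AE_all_countable)
  moreover have "AE \<omega> in M. continuous_on UNIV (\<lambda>t. B t \<omega>)"
    using BM by (simp add: two_sided_BM_def)
  ultimately show ?thesis
  proof eventually_elim
    case (elim \<omega>)
    define b where "b t = B t \<omega>" for t
    have cont: "continuous_on UNIV b" using elim by (simp add: b_def[abs_def])
    have "\<exists>C\<ge>0. \<forall>R\<ge>1. \<forall>x\<in>{- R..R}. \<forall>y\<in>{- R..R}.
        \<bar>b x - b y\<bar> \<le> C * R powr (2 / m) * \<bar>x - y\<bar> powr (1/2 - 1 / m)" if m: "3 \<le> m" for m :: nat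
    proof -
      obtain S where S: "0 \<le> S" and inc: "\<And>p n i. i < 2 ^ n \<Longrightarrow>
          (b (dyadic_point p n (Suc i)) - b (dyadic_point p n i)) ^ (2 * m) \<le> S * 2 ^ (p * (m + 1)) / 2 ^ (n * (m - 2))"
        using elim(1) m unfolding b_def by blast
      define \<gamma> where "\<gamma> = 1/2 - 1 / real m"
      have \<gamma>: "0 < \<gamma>" using m by (simp add: \<gamma>_def field_simps)
      \<comment> \<open>Roots of order 2 m: 2^(p (m + 1)) turns into (2^p)^(1/2 + 1/(2 m)), and 2^(n
        (m - 2)) into \<open>2 powr \<gamma>\<close> to the power n.\<close>
      define K where "K p = S powr (1 / (2 * m)) * (2 ^ p) powr (1/2 + 1 / (2 * m))" for p :: nat
      define A where "A = (1 + 2 / (1 - 2 powr - \<gamma>)) * 2 powr \<gamma>"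
      have "2 powr - \<gamma> < 1" using \<gamma> by (simp add: powr_minus_divide)
      then have A: "0 \<le> A" by (simp add: A_def)
      have K0: "0 \<le> K p" for p by (simp add: K_def)
      have incK: "\<bar>b (dyadic_point p n (Suc i)) - b (dyadic_point p n i)\<bar> \<le> K p * (2 powr - \<gamma>) ^ n"
        if "i < 2 ^ n" for p n i
      proof -
        have "\<bar>b (dyadic_point p n (Suc i)) - b (dyadic_point p n i)\<bar> \<le>
            (S * 2 ^ (p * (m + 1)) / 2 ^ (n * (m - 2))) powr (1 / (2 * m))"
          using le_of_even_power_le[OF inc[OF that]] m S by simp
        also have "\<dots> = S powr (1 / (2 * m)) * (2 ^ (p * (m + 1))) powr (1 / (2 * m)) /
            (2 ^ (n * (m - 2))) powr (1 / (2 * m))"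
          using S by (simp add: powr_divide powr_mult)
        also have "(2 ^ (p * (m + 1))) powr (1 / (2 * m)) = (2 ^ p :: real) powr (1/2 + 1 / (2 * m))"
          using m by (simp add: powr_powr field_simps flip: powr_realpow)
        also have "(2 ^ (n * (m - 2))) powr (1 / (2 * m)) = (2 powr \<gamma> :: real) ^ n"
          using m by (simp add: powr_powr of_nat_diff \<gamma>_def field_simps flip: powr_realpow)
        finally show ?thesis
          by (simp add: K_def powr_minus_divide power_divide)
      qed
      have scale: "\<bar>b x - b y\<bar> \<le> A * K p * (\<bar>x - y\<bar> / 2 ^ Suc p) powr \<gamma>"
        if x: "x \<in> {- (2 ^ p)..2 ^ p}" and y: "y \<in> {- (2 ^ p)..2 ^ p}" for x y p
      proof -
        define f where "f z = b (- (2 ^ p) + 2 ^ Suc p * z)" for z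
        define \<phi> where "\<phi> z = (z + 2 ^ p) / 2 ^ Suc p" for z :: real
        have f\<phi>: "f (\<phi> z) = b z" for z by (simp add: f_def \<phi>_def)
        have \<phi>: "\<phi> z \<in> {0..1}" if "z \<in> {- (2 ^ p)..2 ^ p}" for z
          using that by (simp add: \<phi>_def divide_le_eq)
        have "continuous_on {0..1} f"
          unfolding f_def by (intro continuous_on_compose2[OF cont] continuous_intros) auto
        moreover have "\<bar>f (real (Suc i) / 2 ^ n) - f (real i / 2 ^ n)\<bar> \<le> K p * (2 powr - \<gamma>) ^ n"
          if "i < 2 ^ n" for n i
          using incK[OF that, of p] by (simp add: f_def dyadic_point_def)
        ultimately have "\<bar>f (\<phi> x) - f (\<phi> y)\<bar> \<le> A * K p * \<bar>\<phi> x - \<phi> y\<bar> powr \<gamma>"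
          unfolding A_def using \<gamma> K0 x y by (intro dyadic_increments_imp_Hoelder \<phi>) auto
        moreover have "\<bar>\<phi> x - \<phi> y\<bar> = \<bar>x - y\<bar> / 2 ^ Suc p"
          by (simp add: \<phi>_def abs_divide flip: diff_divide_distrib)
        ultimately show ?thesis by (simp only: f\<phi>)
      qed
      show ?thesis
      proof (intro exI[of _ "A * S powr (1 / (2 * m)) * 2 powr (2 / m)"] conjI allI impI ballI)
        show "0 \<le> A * S powr (1 / (2 * m)) * 2 powr (2 / m)" using A by simp
        fix R x y :: real assume R: "1 \<le> R" and x: "x \<in> {- R..R}" and y: "y \<in> {- R..R}"
        \<comment> \<open>The smallest scale with R <= 2^p; it also satisfies 2^p <= 2 R, whence the
          factor \<open>2 powr (2 / m)\<close> in the constant.\<close>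
        define p where "p = nat \<lceil>log 2 R\<rceil>"
        have log: "0 \<le> log 2 R" using R by simp
        then have p: "log 2 R \<le> real p" "real p \<le> log 2 R + 1" unfolding p_def by linarith+
        have "R = 2 powr log 2 R" using R by simp
        also have "\<dots> \<le> 2 powr real p" using p by simp
        finally have p1: "R \<le> 2 ^ p" by (simp add: powr_realpow)
        have "2 ^ p = 2 powr real p" by (simp add: powr_realpow)
        also have "\<dots> \<le> 2 powr (log 2 R + 1)" using p by simp
        also have "\<dots> = 2 * R" using R by (simp add: powr_add)
        finally have p2: "2 ^ p \<le> 2 * R" .
        have "\<bar>b x - b y\<bar> \<le> A * K p * (\<bar>x - y\<bar> / 2 ^ Suc p) powr \<gamma>"
          using x y p1 by (intro scale) auto
        also have "\<dots> \<le> A * K p * (\<bar>x - y\<bar> / 2 ^ p) powr \<gamma>"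
          using A K0 \<gamma> by (intro mult_left_mono powr_mono2 divide_left_mono) auto
        also have "\<dots> = A * S powr (1 / (2 * m)) * \<bar>x - y\<bar> powr \<gamma> * ((2 ^ p) powr (1/2 + 1 / (2 * m)) / (2 ^ p) powr \<gamma>)"
          by (simp add: K_def powr_divide)
        \<comment> \<open>The exponents differ by 3/(2 m), which is then rounded up to 2/m.\<close>
        also have "(2 ^ p) powr (1/2 + 1 / (2 * m)) / (2 ^ p) powr \<gamma> = (2 ^ p :: real) powr (3 / (2 * m))"
          using m by (subst powr_diff[symmetric]) (simp add: \<gamma>_def field_simps)
        also have "A * S powr (1 / (2 * m)) * \<bar>x - y\<bar> powr \<gamma> * (2 ^ p :: real) powr (3 / (2 * m)) \<le>
            A * S powr (1 / (2 * m)) * \<bar>x - y\<bar> powr \<gamma> * (2 powr (2 / m) * R powr (2 / m))"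
        proof (intro mult_left_mono)
          have "(2 ^ p :: real) powr (3 / (2 * m)) \<le> (2 ^ p) powr (2 / m)"
            using m by (intro powr_mono) (auto simp: field_simps)
          also have "\<dots> \<le> (2 * R) powr (2 / m)"
            using p2 by (intro powr_mono2) auto
          also have "\<dots> = 2 powr (2 / m) * R powr (2 / m)"
            using R by (simp add: powr_mult)
          finally show "(2 ^ p :: real) powr (3 / (2 * m)) \<le> 2 powr (2 / m) * R powr (2 / m)" .
        qed (use A in auto)
        finally show "\<bar>b x - b y\<bar> \<le> A * S powr (1 / (2 * m)) * 2 powr (2 / m) * R powr (2 / m) * \<bar>x - y\<bar> powr (1/2 - 1 / m)"
          by (simp add: \<gamma>_def mult_ac)
      qed
    qed
    then have "Hoelder_growth b"
      unfolding Hoelder_growth_def by (intro conjI cont allI impI)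
    then show ?case unfolding b_def .
  qed
qed

subsection \<open>The two kernels\<close>

text \<open>Separate exponents at 0 and at infinity. Products add the exponents, so each
  integrability question reduces to p > -1 and q < -1.\<close>

definition powr_envelope :: "real \<Rightarrow> real \<Rightarrow> real \<Rightarrow> real" where
  "powr_envelope p q u = (if u \<le> 0 then 0 else if u \<le> 1 then u powr p else u powr q)"

lemma powr_envelope_measurable [measurable]: "powr_envelope p q \<in> borel_measurable borel"
  unfolding powr_envelope_def by measurable

lemma powr_envelope_nonneg: "0 \<le> powr_envelope p q u"
  by (simp add: powr_envelope_def)

lemma powr_envelope_mult: "powr_envelope p q u * powr_envelope p' q' u = powr_envelope (p + p') (q + q') u"
  by (simp add: powr_envelope_def powr_add)

lemma integrable_powr_envelope:
  assumes "- 1 < p" "q < - 1"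
  shows "integrable lborel (powr_envelope p q)"
proof -
  have "(\<integral>\<^sup>+u. ennreal (u powr p) * indicator {0..1} u \<partial>lborel) = ennreal (1 powr (p + 1) / (p + 1))"
    using assms by (intro nn_integral_has_integral_lebesgue' has_integral_powr_from_0) auto
  moreover have "(\<integral>\<^sup>+u. ennreal (u powr q) * indicator {1..} u \<partial>lborel) = ennreal (- (1 powr (q + 1)) / (q + 1))"
    using assms by (intro nn_integral_has_integral_lebesgue' has_integral_powr_to_inf) auto
  moreover have "(\<integral>\<^sup>+u. ennreal (powr_envelope p q u) \<partial>lborel) \<le>
      (\<integral>\<^sup>+u. ennreal (u powr p) * indicator {0..1} u + ennreal (u powr q) * indicator {1..} u \<partial>lborel)"
    by (intro nn_integral_mono) (auto simp: powr_envelope_def)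
  ultimately have "(\<integral>\<^sup>+u. ennreal (powr_envelope p q u) \<partial>lborel) < \<infinity>"
    by (subst (asm) nn_integral_add) (auto intro: le_less_trans)
  then show ?thesis
    by (simp add: integrable_iff_bounded powr_envelope_nonneg)
qed

text \<open>Kernel of the integrals over {0..t}: u = t - s with anchor t in \<open>tX_plus\<close>,
  u = s with anchor 0 in \<open>tX_minus\<close>.\<close>

definition near_kernel :: "real \<Rightarrow> real \<Rightarrow> real \<Rightarrow> real" where
  "near_kernel H t u = (if 0 < u \<and> u < t then u powr (H - 3/2) else 0)"

text \<open>Kernel of the integrals over half-lines: u = - s with anchor 0 in
  \<open>tX_plus\<close>, u = s - t with anchor t in \<open>tX_minus\<close>.\<close>

definition far_kernel :: "real \<Rightarrow> real \<Rightarrow> real \<Rightarrow> real" where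
  "far_kernel H t u = (if 0 < u then (t + u) powr (H - 3/2) - u powr (H - 3/2) else 0)"

lemma near_kernel_measurable [measurable]: "near_kernel H t \<in> borel_measurable borel"
  unfolding near_kernel_def by measurable

lemma far_kernel_measurable [measurable]: "far_kernel H t \<in> borel_measurable borel"
  unfolding far_kernel_def by measurable

text \<open>The exponent at infinity is dictated by \<open>far_kernel\<close>, so that one envelope
  serves both kernels; here it costs a factor u < t <= T. The bracket [h, h'] makes the bound
  uniform near a given H.\<close>

lemma near_kernel_bound:
  assumes H: "h \<le> H" "H \<le> h'" and t: "t \<le> T" "0 \<le> T"
  shows "\<bar>near_kernel H t u\<bar> \<le> (1 + 2 * T) * powr_envelope (h - 3/2) (h' - 5/2) u"
proof (cases "0 < u \<and> u < t")
  case True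
  show ?thesis
  proof (cases "u \<le> 1")
    case u: True
    have "u powr (H - 3/2) \<le> 1 * u powr (h - 3/2)"
      using True u H by (simp add: powr_mono')
    also have "\<dots> \<le> (1 + 2 * T) * u powr (h - 3/2)"
      using t by (intro mult_right_mono) auto
    finally show ?thesis using True u by (simp add: near_kernel_def powr_envelope_def)
  next
    case u: False
    have "u powr (H - 3/2) \<le> u powr (1 + (h' - 5/2))"
      using u H by (intro powr_mono) auto
    also have "\<dots> = u * u powr (h' - 5/2)"
      using u by (subst powr_add) auto
    also have "\<dots> \<le> (1 + 2 * T) * u powr (h' - 5/2)"
      using True t by (intro mult_right_mono) auto
    finally show ?thesis using True u by (simp add: near_kernel_def powr_envelope_def)
  qed
next
  case False
  then have "near_kernel H t u = 0" by (auto simp: near_kernel_def)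
  then show ?thesis using t by (simp add: powr_envelope_nonneg)
qed

text \<open>For u <= 1 the kernel is dominated by its singular term. For u > 1 the mean value
  theorem gains one power of u, at the cost of t (3/2 - H) <= 2 T.\<close>

lemma far_kernel_bound:
  assumes H: "h \<le> H" "H \<le> h'" "0 \<le> H" "H \<le> 1" and t: "0 \<le> t" "t \<le> T"
  shows "\<bar>far_kernel H t u\<bar> \<le> (1 + 2 * T) * powr_envelope (h - 3/2) (h' - 5/2) u"
proof (cases "0 < u")
  case True
  have dec: "(t + u) powr (H - 3/2) \<le> u powr (H - 3/2)"
    using True H t by (intro powr_mono2') auto
  then have abs: "\<bar>far_kernel H t u\<bar> = u powr (H - 3/2) - (t + u) powr (H - 3/2)"
    using True by (simp add: far_kernel_def)
  show ?thesis
  proof (cases "u \<le> 1")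
    case u: True
    have "\<bar>far_kernel H t u\<bar> \<le> 1 * u powr (H - 3/2)" by (simp add: abs)
    also have "\<dots> \<le> (1 + 2 * T) * u powr (h - 3/2)"
      using t True u H by (intro mult_mono powr_mono') auto
    finally show ?thesis using True u by (simp add: powr_envelope_def)
  next
    case u: False
    show ?thesis
    proof (cases "t = 0")
      case True
      then show ?thesis using t by (simp add: far_kernel_def powr_envelope_nonneg)
    next
      case False
      have "\<exists>z. u < z \<and> z < t + u \<and> (t + u) powr (H - 3/2) - u powr (H - 3/2) =
          (t + u - u) * ((H - 3/2) * z powr (H - 3/2 - 1))"
        using False t True
        by (intro MVT2) (auto intro!: derivative_eq_intros)
      then obtain z where z: "u < z" "(t + u) powr (H - 3/2) - u powr (H - 3/2) =
          t * ((H - 3/2) * z powr (H - 3/2 - 1))" by auto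
      have "\<bar>far_kernel H t u\<bar> = t * (3/2 - H) * z powr (H - 3/2 - 1)"
        unfolding abs using z(2) by (simp add: algebra_simps)
      also have "\<dots> \<le> (1 + 2 * T) * u powr (h' - 5/2)"
      proof (intro mult_mono)
        have "t * (3/2 - H) \<le> T * 2" using t H by (intro mult_mono) auto
        then show "t * (3/2 - H) \<le> 1 + 2 * T" by simp
        have "z powr (H - 3/2 - 1) \<le> u powr (H - 3/2 - 1)"
          using True z H by (intro powr_mono2') auto
        also have "\<dots> \<le> u powr (h' - 5/2)" using u H by (intro powr_mono) auto
        finally show "z powr (H - 3/2 - 1) \<le> u powr (h' - 5/2)" .
      qed (use t in auto)
      finally show ?thesis using u True by (simp add: powr_envelope_def)
    qed
  qed
next
  case False
  then show ?thesis using t by (simp add: far_kernel_def powr_envelope_nonneg)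
qed

text \<open>The factor sqrt u raises the exponents to H - 1 and H - 2, integrable at 0 and at
  infinity because 0 < H < 1.\<close>

lemma integrable_kernel_sqrt:
  assumes [measurable]: "k \<in> borel_measurable borel"
    and bound: "\<And>u. \<bar>k u\<bar> \<le> C * powr_envelope (H - 3/2) (H - 5/2) u" and H: "0 < H" "H < 1"
  shows "integrable lborel (\<lambda>u. k u * sqrt \<bar>u\<bar>)"
proof (rule Bochner_Integration.integrable_bound)
  show "integrable lborel (\<lambda>u. C * powr_envelope (H - 1) (H - 2) u)"
    using H by (intro integrable_mult_right integrable_powr_envelope) auto
  have "\<bar>k u\<bar> * sqrt \<bar>u\<bar> \<le> \<bar>C * powr_envelope (H - 1) (H - 2) u\<bar>" for u
  proof (cases "0 < u")
    case True
    then have "sqrt \<bar>u\<bar> = powr_envelope (1/2) (1/2) u"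
      by (simp add: powr_envelope_def powr_half_sqrt)
    then have "\<bar>k u\<bar> * sqrt \<bar>u\<bar> \<le> C * powr_envelope (H - 3/2) (H - 5/2) u * powr_envelope (1/2) (1/2) u"
      using bound[of u] by (simp add: mult_right_mono powr_envelope_nonneg)
    then show ?thesis by (simp add: powr_envelope_mult mult.assoc)
  next
    case False
    then have "\<bar>k u\<bar> \<le> 0" using bound[of u] by (simp add: powr_envelope_def)
    then show ?thesis by simp
  qed
  then show "AE u in lborel. norm (k u * sqrt \<bar>u\<bar>) \<le> norm (C * powr_envelope (H - 1) (H - 2) u)"
    by (simp add: abs_mult)
qed measurable

section \<open>Tail integrals of the kernels\<close>

text \<open>The kernel times H - 1/2 is the derivative of u^(H - 1/2) up to the cut-off t, where the
  boundary value t^(H - 1/2) appears.\<close>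

lemma near_kernel_tail:
  assumes y: "0 < y"
  shows "(H - 1/2) * (LINT u|lborel. near_kernel H t u * indicator {y..} u) =
    (if y < t then t powr (H - 1/2) - y powr (H - 1/2) else 0)"
proof (cases "y < t")
  case True
  have "(H - 1/2) * (LINT u|lborel. near_kernel H t u * indicator {y..} u) =
      (LINT u|lborel. indicator {y..t} u *\<^sub>R ((H - 1/2) * u powr (H - 1/2 - 1)))"
    unfolding integral_mult_right_zero[symmetric]
  proof (rule integral_cong_AE)
    have "AE u in lborel. u \<noteq> t" by (rule AE_lborel_singleton)
    then show "AE u in lborel. (H - 1/2) * (near_kernel H t u * indicator {y..} u) =
        indicator {y..t} u *\<^sub>R ((H - 1/2) * u powr (H - 1/2 - 1))"
      by eventually_elim (use y in \<open>auto simp: near_kernel_def indicator_def\<close>)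
  qed auto
  also have "\<dots> = t powr (H - 1/2) - y powr (H - 1/2)"
    using True y by (intro integral_FTC_atLeastAtMost)
      (auto intro!: continuous_intros derivative_eq_intros simp flip: has_real_derivative_iff_has_vector_derivative)
  finally show ?thesis using True by simp
next
  case False
  then have "(\<lambda>u. near_kernel H t u * indicator {y..} u) = (\<lambda>u. 0)"
    by (auto simp: near_kernel_def indicator_def)
  then show ?thesis using False by simp
qed

lemma powr_increment_tendsto_0:
  fixes a t :: real
  assumes "a < 1" "0 \<le> t"
  shows "((\<lambda>x. (t + x) powr a - x powr a) \<longlongrightarrow> 0) at_top"
proof (cases "t = 0")
  case False
  with assms have t: "0 < t" by simp
  consider "a < 0" | "a = 0" | "0 < a" by linarith
  then show ?thesis
  proof cases
    case 1
    then show ?thesis using t by real_asymp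
  next
    case 2
    have "\<forall>\<^sub>F x in at_top. 0 = (t + x) powr a - x powr a"
      using eventually_gt_at_top[of 0] by eventually_elim (use 2 t in simp)
    then show ?thesis by (rule Lim_transform_eventually[OF tendsto_const])
  next
    case 3
    then show ?thesis using t \<open>a < 1\<close> by real_asymp
  qed
qed simp

text \<open>The antiderivative F vanishes at infinity although its two powers may diverge
  separately, because their common exponent is below 1. So, unlike for the near kernel, no boundary
  value is left over.\<close>

lemma far_kernel_tail:
  assumes y: "0 < y" and H: "0 < H" "H < 1" and t: "0 \<le> t"
  shows "(H - 1/2) * (LINT u|lborel. far_kernel H t u * indicator {y..} u) =
    y powr (H - 1/2) - (t + y) powr (H - 1/2)"
proof -
  define F where "F u = (t + u) powr (H - 1/2) - u powr (H - 1/2)" for u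
  define f where "f u = (H - 1/2) * far_kernel H t u" for u
  have [measurable]: "f \<in> borel_measurable borel" unfolding f_def by measurable
  have int: "integrable lborel (\<lambda>u. far_kernel H t u * sqrt \<bar>u\<bar>)"
    using far_kernel_bound[of H H H t t] H t by (intro integrable_kernel_sqrt) auto
  have "set_integrable lborel {y..} f"
    unfolding set_integrable_def
  proof (rule Bochner_Integration.integrable_bound)
    \<comment> \<open>For u >= y the factor sqrt u / sqrt y is at least 1, so the weighted
      integrability suffices away from 0.\<close>
    show "integrable lborel (\<lambda>u. (H - 1/2) / sqrt y * (far_kernel H t u * sqrt \<bar>u\<bar>))"
      by (intro integrable_mult_right int)
    have "\<bar>indicator {y..} u *\<^sub>R f u\<bar> \<le> \<bar>(H - 1/2) / sqrt y * (far_kernel H t u * sqrt \<bar>u\<bar>)\<bar>" for u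
    proof (cases "y \<le> u")
      case True
      then have "1 \<le> sqrt \<bar>u\<bar> / sqrt y" using y by simp
      from mult_left_mono[OF this, of "\<bar>f u\<bar>"] show ?thesis
        using True y by (simp add: f_def abs_mult mult_ac)
    qed simp
    then show "AE u in lborel. norm (indicator {y..} u *\<^sub>R f u) \<le>
        norm ((H - 1/2) / sqrt y * (far_kernel H t u * sqrt \<bar>u\<bar>))" by simp
  qed measurable
  then have lim: "((\<lambda>b. LINT u:{y..b}|lborel. f u) \<longlongrightarrow> (LINT u:{y..}|lborel. f u)) at_top"
    by (intro tendsto_set_lebesgue_integral_at_top) auto
  have FTC: "(LINT u:{y..b}|lborel. f u) = F b - F y" if "y \<le> b" for b
  proof -
    have "(LINT u:{y..b}|lborel. f u) = (LINT u|lborel. indicator {y..b} u *\<^sub>R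
        ((H - 1/2) * (t + u) powr (H - 1/2 - 1) - (H - 1/2) * u powr (H - 1/2 - 1)))"
      unfolding set_lebesgue_integral_def using y
      by (intro Bochner_Integration.integral_cong)
         (auto simp: f_def far_kernel_def right_diff_distrib indicator_def)
    also have "\<dots> = F b - F y"
      unfolding F_def using that y t
      by (intro integral_FTC_atLeastAtMost)
        (auto intro!: continuous_intros derivative_eq_intros
          simp flip: has_real_derivative_iff_has_vector_derivative)
    finally show ?thesis .
  qed
  then have ev: "\<forall>\<^sub>F b in at_top. (LINT u:{y..b}|lborel. f u) = F b - F y"
    by (intro eventually_mono[OF eventually_ge_at_top[of y]])
  have lim': "((\<lambda>b. F b - F y) \<longlongrightarrow> 0 - F y) at_top"
    unfolding F_def using H t by (intro tendsto_intros powr_increment_tendsto_0) auto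
  have "(LINT u:{y..}|lborel. f u) = 0 - F y"
    by (rule tendsto_unique[OF _ Lim_transform_eventually[OF lim ev] lim']) simp
  moreover have "(LINT u:{y..}|lborel. f u) = (H - 1/2) * (LINT u|lborel. far_kernel H t u * indicator {y..} u)"
    unfolding set_lebesgue_integral_def f_def integral_mult_right_zero[symmetric]
    by (simp add: mult_ac)
  ultimately show ?thesis by (simp add: F_def)
qed

subsection \<open>Joint continuity\<close>

text \<open>Take R = T + 1 for u <= 1 and R = T + u <= (T + 1) u otherwise; the exponent at infinity
  is 2/m + 1/2 - 1/m. The constant is uniform over anchors in [0, T] and both directions.\<close>

lemma Hoelder_growth_increment:
  assumes b: "Hoelder_growth b" and m: "(3::nat) \<le> m" and T: "0 \<le> T"
  obtains C where "0 \<le> C" "\<And>r u \<sigma>. 0 \<le> r \<Longrightarrow> r \<le> T \<Longrightarrow> \<bar>\<sigma>\<bar> = 1 \<Longrightarrow> 0 < u \<Longrightarrow>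
    \<bar>b (r + \<sigma> * u) - b r\<bar> \<le> C * powr_envelope (1/2 - 1 / m) (1/2 + 1 / m) u"
proof -
  from b[unfolded Hoelder_growth_def, THEN conjunct2, rule_format, OF m]
  obtain C where C: "0 \<le> C" and all: "\<forall>R\<ge>1. \<forall>x\<in>{- R..R}. \<forall>y\<in>{- R..R}.
      \<bar>b x - b y\<bar> \<le> C * R powr (2 / m) * \<bar>x - y\<bar> powr (1/2 - 1 / m)"
    by (elim exE conjE)
  note bound = all[rule_format]
  show thesis
  proof (rule that)
    show "0 \<le> C * (T + 1) powr (2 / m)" using C by simp
    fix r u \<sigma> :: real
    assume r: "0 \<le> r" "r \<le> T" and \<sigma>: "\<bar>\<sigma>\<bar> = 1" and u: "0 < u"
    from \<sigma> have "\<sigma> = 1 \<or> \<sigma> = - 1" by linarith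
    then have mem: "r + \<sigma> * u \<in> {- (T + u)..T + u}" "r \<in> {- (T + u)..T + u}"
      and dist: "\<bar>\<sigma> * u\<bar> = u"
      using r u by auto
    show "\<bar>b (r + \<sigma> * u) - b r\<bar> \<le> C * (T + 1) powr (2 / m) * powr_envelope (1/2 - 1 / m) (1/2 + 1 / m) u"
    proof (cases "u \<le> 1")
      case True
      have "\<bar>b (r + \<sigma> * u) - b r\<bar> \<le> C * (T + 1) powr (2 / m) * \<bar>(r + \<sigma> * u) - r\<bar> powr (1/2 - 1 / m)"
        using mem True T by (intro bound) auto
      then show ?thesis using u True by (simp add: dist powr_envelope_def)
    next
      case False
      have "\<bar>b (r + \<sigma> * u) - b r\<bar> \<le> C * (T + u) powr (2 / m) * \<bar>(r + \<sigma> * u) - r\<bar> powr (1/2 - 1 / m)"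
        using mem False T by (intro bound) auto
      also have "\<dots> \<le> C * ((T + 1) * u) powr (2 / m) * \<bar>(r + \<sigma> * u) - r\<bar> powr (1/2 - 1 / m)"
      proof (intro mult_right_mono mult_left_mono powr_mono2)
        have "T * 1 \<le> T * u" using T False by (intro mult_left_mono) auto
        then show "T + u \<le> (T + 1) * u" by (simp add: algebra_simps)
      qed (use T u C in auto)
      also have "\<dots> = C * (T + 1) powr (2 / m) * u powr (1/2 + 1 / m)"
        using u T m by (simp add: dist powr_mult mult.assoc flip: powr_add) (simp add: field_simps)
      finally show ?thesis using u False by (simp add: powr_envelope_def)
    qed
  qed
qed

text \<open>Abstract in \<open>\<kappa>\<close>, \<open>\<rho>\<close> and \<open>\<sigma>\<close>
  to cover all four integrals; \<open>\<rho> t\<close> is the anchor, either t or 0.\<close>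

lemma kernel_integral_continuous_on:
  fixes \<kappa> :: "real \<Rightarrow> real \<Rightarrow> real \<Rightarrow> real"
  assumes b: "Hoelder_growth b" and \<sigma>: "\<bar>\<sigma>\<bar> = 1"
    and meas [measurable]: "\<And>H t. \<kappa> H t \<in> borel_measurable borel"
    and bound: "\<And>h h' H t T u. h \<le> H \<Longrightarrow> H \<le> h' \<Longrightarrow> 0 \<le> H \<Longrightarrow> H \<le> 1 \<Longrightarrow> 0 \<le> t \<Longrightarrow> t \<le> T \<Longrightarrow>
        \<bar>\<kappa> H t u\<bar> \<le> (1 + 2 * T) * powr_envelope (h - 3/2) (h' - 5/2) u"
    and lim: "\<And>h s H t u. h \<longlonglongrightarrow> H \<Longrightarrow> s \<longlonglongrightarrow> t \<Longrightarrow> 0 \<le> t \<Longrightarrow> u \<noteq> t \<Longrightarrow>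
        (\<lambda>n. \<kappa> (h n) (s n) u) \<longlonglongrightarrow> \<kappa> H t u"
    and \<rho>: "continuous_on {0..} \<rho>" "\<And>t. 0 \<le> t \<Longrightarrow> 0 \<le> \<rho> t" "\<And>t. 0 \<le> t \<Longrightarrow> \<rho> t \<le> t"
  shows "continuous_on ({0<..<1} \<times> {0..})
    (\<lambda>(H, t). LINT u|lborel. \<kappa> H t u * (b (\<rho> t + \<sigma> * u) - b (\<rho> t)))"
proof (rule continuous_on_sequentiallyI)
  fix X :: "nat \<Rightarrow> real \<times> real" and a
  assume X: "\<forall>n. X n \<in> {0<..<1} \<times> {0..}" and a: "a \<in> {0<..<1} \<times> {0..}" and lim_X: "X \<longlonglongrightarrow> a"
  obtain H t where a_eq: "a = (H, t)" by (cases a)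
  define h s where "h n = fst (X n)" and "s n = snd (X n)" for n
  have Ht: "0 < H" "H < 1" "0 \<le> t" using a by (auto simp: a_eq)
  have hs: "0 < h n" "h n < 1" "0 \<le> s n" for n using X[rule_format, of n] by (auto simp: h_def s_def)
  have lim_h: "h \<longlonglongrightarrow> H" and lim_s: "s \<longlonglongrightarrow> t"
    using tendsto_fst[OF lim_X] tendsto_snd[OF lim_X] by (simp_all add: h_def[abs_def] s_def[abs_def] a_eq)
  have contb: "continuous_on UNIV b" using b by (simp add: Hoelder_growth_def)
  then have [measurable]: "b \<in> borel_measurable borel" by (rule borel_measurable_continuous_onI)
  define T where "T = t + 1"
  have "\<forall>\<^sub>F n in sequentially. H / 2 < h n \<and> h n < (1 + H) / 2 \<and> s n < T"
    using order_tendstoD(1)[OF lim_h, of "H / 2"] order_tendstoD(2)[OF lim_h, of "(1 + H) / 2"]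
      order_tendstoD(2)[OF lim_s, of T] Ht by (simp add: T_def eventually_conj_iff)
  then obtain N where N: "\<And>n. N \<le> n \<Longrightarrow> H / 2 < h n \<and> h n < (1 + H) / 2 \<and> s n < T"
    by (auto simp: eventually_sequentially)
  \<comment> \<open>With h n between H/2 and (1 + H)/2 the majorant has exponents H/2 - 1 - 1/m at 0
    and (1 + H)/2 - 2 + 1/m at infinity; these choices make them > -1 and < -1.\<close>
  obtain m :: nat where m: "3 \<le> m" "1 / m < H / 2" "1 / m < (1 - H) / 2"
  proof -
    obtain k :: nat where k: "3 + 2 / H + 2 / (1 - H) < k" using reals_Archimedean2 by blast
    have pos: "0 < 2 / H" "0 < 2 / (1 - H)" using Ht by auto
    with k have "3 \<le> k" "2 / H < k" "2 / (1 - H) < k" by linarith+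
    with Ht show ?thesis by (intro that[of k]) (auto simp: field_simps)
  qed
  from Ht have "0 \<le> T" by (simp add: T_def)
  then obtain C where C: "0 \<le> C" "\<And>r u \<sigma>. 0 \<le> r \<Longrightarrow> r \<le> T \<Longrightarrow> \<bar>\<sigma>\<bar> = 1 \<Longrightarrow> 0 < u \<Longrightarrow>
      \<bar>b (r + \<sigma> * u) - b r\<bar> \<le> C * powr_envelope (1/2 - 1 / m) (1/2 + 1 / m) u"
    using Hoelder_growth_increment[OF b m(1)] by blast
  have "(\<lambda>n. LINT u|lborel. \<kappa> (h (n + N)) (s (n + N)) u * (b (\<rho> (s (n + N)) + \<sigma> * u) - b (\<rho> (s (n + N)))))
      \<longlonglongrightarrow> (LINT u|lborel. \<kappa> H t u * (b (\<rho> t + \<sigma> * u) - b (\<rho> t)))"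
  proof (rule integral_dominated_convergence)
    let ?w = "\<lambda>u. (1 + 2 * T) * C * powr_envelope (H / 2 - 3/2 + (1/2 - 1 / m)) ((1 + H) / 2 - 5/2 + (1/2 + 1 / m)) u"
    show "integrable lborel ?w"
      using m by (intro integrable_mult_right integrable_powr_envelope) argo+
    have "\<bar>\<kappa> (h n) (s n) u * (b (\<rho> (s n) + \<sigma> * u) - b (\<rho> (s n)))\<bar> \<le> ?w u" if "N \<le> n" for n u
    proof (cases "0 < u")
      case True
      have "\<bar>\<kappa> (h n) (s n) u\<bar> * \<bar>b (\<rho> (s n) + \<sigma> * u) - b (\<rho> (s n))\<bar> \<le>
          ((1 + 2 * T) * powr_envelope (H / 2 - 3/2) ((1 + H) / 2 - 5/2) u) *
          (C * powr_envelope (1/2 - 1 / m) (1/2 + 1 / m) u)"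
      proof (intro mult_mono bound C(2))
        show "\<rho> (s n) \<le> T" using \<rho>(3)[OF hs(3)[of n]] N[OF that] by linarith
      qed (use N[OF that] hs[of n] \<rho> \<sigma> True \<open>0 \<le> T\<close> in \<open>auto simp: powr_envelope_nonneg\<close>)
      also have "\<dots> = (1 + 2 * T) * C * (powr_envelope (H / 2 - 3/2) ((1 + H) / 2 - 5/2) u *
          powr_envelope (1/2 - 1 / m) (1/2 + 1 / m) u)" by (simp only: mult_ac)
      finally show ?thesis by (simp only: abs_mult powr_envelope_mult)
    next
      case False
      have "\<bar>\<kappa> (h n) (s n) u\<bar> \<le> (1 + 2 * T) * powr_envelope (H / 2 - 3/2) ((1 + H) / 2 - 5/2) u"
        using N[OF that] hs[of n] by (intro bound) auto
      then have "\<kappa> (h n) (s n) u = 0" using False by (simp add: powr_envelope_def)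
      then show ?thesis using C \<open>0 \<le> T\<close> by (simp add: powr_envelope_nonneg)
    qed
    then show "AE u in lborel. norm (\<kappa> (h (n + N)) (s (n + N)) u *
        (b (\<rho> (s (n + N)) + \<sigma> * u) - b (\<rho> (s (n + N))))) \<le> ?w u" for n
      by simp
    \<comment> \<open>The near kernel jumps at its cut-off u = t.\<close>
    have "AE u in lborel. u \<noteq> t" by (rule AE_lborel_singleton)
    then show "AE u in lborel. (\<lambda>n. \<kappa> (h (n + N)) (s (n + N)) u *
        (b (\<rho> (s (n + N)) + \<sigma> * u) - b (\<rho> (s (n + N))))) \<longlonglongrightarrow>
        \<kappa> H t u * (b (\<rho> t + \<sigma> * u) - b (\<rho> t))"
    proof eventually_elim
      case (elim u)
      have h': "(\<lambda>n. h (n + N)) \<longlonglongrightarrow> H" and s': "(\<lambda>n. s (n + N)) \<longlonglongrightarrow> t"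
        using lim_h lim_s by (auto intro: LIMSEQ_ignore_initial_segment)
      have \<rho>': "(\<lambda>n. \<rho> (s (n + N))) \<longlonglongrightarrow> \<rho> t"
        by (rule continuous_on_tendsto_compose[OF \<rho>(1) s']) (use Ht hs in auto)
      have b': "(\<lambda>n. b (r n)) \<longlonglongrightarrow> b l" if "r \<longlonglongrightarrow> l" for r l
        by (rule continuous_on_tendsto_compose[OF contb that]) auto
      show ?case
        by (intro tendsto_mult tendsto_diff b' lim[OF h' s' Ht(3) elim] \<rho>' tendsto_add tendsto_const)
    qed
  qed measurable
  then have "(\<lambda>n. LINT u|lborel. \<kappa> (h n) (s n) u * (b (\<rho> (s n) + \<sigma> * u) - b (\<rho> (s n))))
      \<longlonglongrightarrow> (LINT u|lborel. \<kappa> H t u * (b (\<rho> t + \<sigma> * u) - b (\<rho> t)))"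
    by (rule LIMSEQ_offset)
  then show "(\<lambda>n. case X n of (H, t) \<Rightarrow> LINT u|lborel. \<kappa> H t u * (b (\<rho> t + \<sigma> * u) - b (\<rho> t)))
      \<longlonglongrightarrow> (case a of (H, t) \<Rightarrow> LINT u|lborel. \<kappa> H t u * (b (\<rho> t + \<sigma> * u) - b (\<rho> t)))"
    by (simp add: a_eq h_def s_def split_beta)
qed

lemma near_kernel_tendsto:
  assumes h: "h \<longlonglongrightarrow> H" and s: "s \<longlonglongrightarrow> t" and "u \<noteq> t"
  shows "(\<lambda>n. near_kernel (h n) (s n) u) \<longlonglongrightarrow> near_kernel H t u"
proof (cases "0 < u \<and> u < t")
  case True
  have "\<forall>\<^sub>F n in sequentially. u < s n" using order_tendstoD(1)[OF s] True by blast
  then have "\<forall>\<^sub>F n in sequentially. u powr (h n - 3/2) = near_kernel (h n) (s n) u"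
    by eventually_elim (use True in \<open>simp add: near_kernel_def\<close>)
  moreover have "(\<lambda>n. u powr (h n - 3/2)) \<longlonglongrightarrow> near_kernel H t u"
    using True by (auto simp: near_kernel_def intro!: tendsto_intros h)
  ultimately show ?thesis by (rule Lim_transform_eventually[rotated])
next
  case False
  have "\<forall>\<^sub>F n in sequentially. 0 = near_kernel (h n) (s n) u"
  proof (cases "0 < u")
    case True
    then have "t < u" using False \<open>u \<noteq> t\<close> by auto
    then have "\<forall>\<^sub>F n in sequentially. s n < u" using order_tendstoD(2)[OF s] by blast
    then show ?thesis by eventually_elim (simp add: near_kernel_def)
  qed (simp add: near_kernel_def)
  moreover have "near_kernel H t u = 0" using False by (auto simp: near_kernel_def)
  ultimately show ?thesis using Lim_transform_eventually[OF tendsto_const] by metis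
qed

lemma far_kernel_tendsto:
  assumes "h \<longlonglongrightarrow> H" "s \<longlonglongrightarrow> t" "0 \<le> t"
  shows "(\<lambda>n. far_kernel (h n) (s n) u) \<longlonglongrightarrow> far_kernel H t u"
  using assms by (cases "0 < u") (auto simp: far_kernel_def intro!: tendsto_intros)

text \<open>The difficulty is t = 0, where t^(H - 1/2) blows up for H < 1/2. Hoelder continuity of
  order 1/2 - 1/k with 1/k < H bounds the product by a multiple of t^(h - 1/k), and the limiting
  exponent H - 1/k is positive.\<close>

lemma powr_times_continuous_on:
  assumes b: "Hoelder_growth b" and b0: "b 0 = 0"
  shows "continuous_on ({0<..<1} \<times> {0..}) (\<lambda>(H, t). t powr (H - 1/2) * b t)"
proof (rule continuous_on_sequentiallyI)
  fix X :: "nat \<Rightarrow> real \<times> real" and a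
  assume X: "\<forall>n. X n \<in> {0<..<1} \<times> {0..}" and a: "a \<in> {0<..<1} \<times> {0..}" and lim_X: "X \<longlonglongrightarrow> a"
  obtain H t where a_eq: "a = (H, t)" by (cases a)
  define h s where "h n = fst (X n)" and "s n = snd (X n)" for n
  have Ht: "0 < H" "H < 1" "0 \<le> t" using a by (auto simp: a_eq)
  have hs: "0 < h n" "h n < 1" "0 \<le> s n" for n using X[rule_format, of n] by (auto simp: h_def s_def)
  have lim_h: "h \<longlonglongrightarrow> H" and lim_s: "s \<longlonglongrightarrow> t"
    using tendsto_fst[OF lim_X] tendsto_snd[OF lim_X] by (simp_all add: h_def[abs_def] s_def[abs_def] a_eq)
  have contb: "continuous_on UNIV b" using b by (simp add: Hoelder_growth_def)
  have "(\<lambda>n. s n powr (h n - 1/2) * b (s n)) \<longlonglongrightarrow> t powr (H - 1/2) * b t"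
  proof (cases "t = 0")
    case False
    then show ?thesis
      by (intro tendsto_intros lim_s lim_h continuous_on_tendsto_compose[OF contb lim_s]) auto
  next
    case True
    obtain k :: nat where k: "3 + 1 / H < k" using reals_Archimedean2 by blast
    have "0 < 1 / H" using Ht by simp
    with k have "3 \<le> k" "1 / H < k" by linarith+
    then have k: "3 \<le> k" "1 / k < H" using Ht by (auto simp: field_simps)
    obtain C where C: "0 \<le> C" "\<And>r u \<sigma>. 0 \<le> r \<Longrightarrow> r \<le> 0 \<Longrightarrow> \<bar>\<sigma>\<bar> = 1 \<Longrightarrow> 0 < u \<Longrightarrow>
        \<bar>b (r + \<sigma> * u) - b r\<bar> \<le> C * powr_envelope (1/2 - 1 / k) (1/2 + 1 / k) u"
      using Hoelder_growth_increment[OF b k(1), of 0] by auto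
    have le: "\<bar>s n powr (h n - 1/2) * b (s n)\<bar> \<le> C * s n powr (h n - 1 / k)" if "s n < 1" for n
    proof (cases "s n = 0")
      case False
      then have s: "0 < s n" using hs(3)[of n] by simp
      have "\<bar>b (s n)\<bar> \<le> C * s n powr (1/2 - 1 / k)"
        using C(2)[of 0 1 "s n"] s that by (simp add: b0 powr_envelope_def)
      from mult_left_mono[OF this, of "s n powr (h n - 1/2)"] s
      have "\<bar>s n powr (h n - 1/2) * b (s n)\<bar> \<le> C * (s n powr (h n - 1/2) * s n powr (1/2 - 1 / k))"
        by (simp add: abs_mult mult_ac)
      also have "s n powr (h n - 1/2) * s n powr (1/2 - 1 / k) = s n powr (h n - 1 / k)"
        by (simp flip: powr_add)
      finally show ?thesis .
    qed (simp add: b0)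
    have "\<forall>\<^sub>F n in sequentially. s n < 1" using order_tendstoD(2)[OF lim_s, of 1] True by simp
    then have "\<forall>\<^sub>F n in sequentially. norm (s n powr (h n - 1/2) * b (s n)) \<le> C * s n powr (h n - 1 / k)"
      by eventually_elim (simp add: le)
    moreover have "(\<lambda>n. C * s n powr (h n - 1 / k)) \<longlonglongrightarrow> C * t powr (H - 1 / k)"
      by (intro tendsto_mult tendsto_const tendsto_powr' tendsto_diff lim_s lim_h) (use hs k in auto)
    then have "(\<lambda>n. C * s n powr (h n - 1 / k)) \<longlonglongrightarrow> 0"
      using True by simp
    ultimately have "(\<lambda>n. s n powr (h n - 1/2) * b (s n)) \<longlonglongrightarrow> 0"
      by (rule Lim_null_comparison)
    then show ?thesis using True by simp
  qed
  then show "(\<lambda>n. case X n of (H, t) \<Rightarrow> t powr (H - 1/2) * b t) \<longlonglongrightarrow> (case a of (H, t) \<Rightarrow> t powr (H - 1/2) * b t)"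
    by (simp add: a_eq h_def s_def split_beta)
qed

section \<open>Change of variables in the pathwise integrals\<close>

text \<open>The minus sign before the near integral is absorbed by reversing b t - b s. The case t =
  0 needs no exception, since both kernels vanish there. The unsimplified \<open>t + - 1 * u\<close>
  fits the pattern \<open>r + \<sigma> * u\<close>.\<close>

lemma tX_plus_eq:
  assumes [measurable]: "b \<in> borel_measurable borel" and b0: "b 0 = 0" and t: "0 \<le> t"
  shows "tX_plus b H t = t powr (H - 1/2) * b t
    + (H - 1/2) * (LINT u|lborel. near_kernel H t u * (b (t + - 1 * u) - b t))
    + (H - 1/2) * (LINT u|lborel. far_kernel H t u * (b (0 + - 1 * u) - b 0))"
proof (cases "t = 0")
  case True
  have "near_kernel H 0 u = 0" "far_kernel H 0 u = 0" for u
    by (auto simp: near_kernel_def far_kernel_def)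
  then show ?thesis using True by (simp add: tX_plus_def)
next
  case False
  have "(LINT s:{0..t}|lborel. (t - s) powr (H - 3/2) * (b t - b s)) =
      (LINT u|lborel. indicator {0..t} (t + - 1 * u) *\<^sub>R ((t - (t + - 1 * u)) powr (H - 3/2) * (b t - b (t + - 1 * u))))"
    unfolding set_lebesgue_integral_def by (subst lborel_integral_real_affine[of "- 1" _ t]) auto
  also have "\<dots> = (LINT u|lborel. - (near_kernel H t u * (b (t + - 1 * u) - b t)))"
  proof (rule integral_cong_AE)
    have "AE u in lborel. u \<noteq> t" by (rule AE_lborel_singleton)
    then show "AE u in lborel. indicator {0..t} (t + - 1 * u) *\<^sub>R ((t - (t + - 1 * u)) powr (H - 3/2) *
        (b t - b (t + - 1 * u))) = - (near_kernel H t u * (b (t + - 1 * u) - b t))"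
      by eventually_elim (auto simp: near_kernel_def indicator_def algebra_simps)
  qed measurable
  finally have near: "(LINT s:{0..t}|lborel. (t - s) powr (H - 3/2) * (b t - b s)) =
      - (LINT u|lborel. near_kernel H t u * (b (t + - 1 * u) - b t))" by simp
  have "(LINT s:{..0}|lborel. ((t - s) powr (H - 3/2) - (- s) powr (H - 3/2)) * b s) =
      (LINT u|lborel. indicator {..0} (0 + - 1 * u) *\<^sub>R
        (((t - (0 + - 1 * u)) powr (H - 3/2) - (- (0 + - 1 * u)) powr (H - 3/2)) * b (0 + - 1 * u)))"
    unfolding set_lebesgue_integral_def by (subst lborel_integral_real_affine[of "- 1" _ 0]) auto
  also have "\<dots> = (LINT u|lborel. far_kernel H t u * (b (0 + - 1 * u) - b 0))"
  proof (rule integral_cong_AE)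
    have "AE u in lborel. u \<noteq> (0::real)" by (rule AE_lborel_singleton)
    then show "AE u in lborel. indicator {..0} (0 + - 1 * u) *\<^sub>R
        (((t - (0 + - 1 * u)) powr (H - 3/2) - (- (0 + - 1 * u)) powr (H - 3/2)) * b (0 + - 1 * u)) =
        far_kernel H t u * (b (0 + - 1 * u) - b 0)"
      by eventually_elim (auto simp: far_kernel_def indicator_def b0)
  qed measurable
  finally show ?thesis
    using False by (simp only: tX_plus_def near if_False)
qed

lemma tX_minus_eq:
  assumes [measurable]: "b \<in> borel_measurable borel" and b0: "b 0 = 0" and t: "0 \<le> t"
  shows "tX_minus b H t = - (t powr (H - 1/2) * b t)
    + (H - 1/2) * (LINT u|lborel. near_kernel H t u * (b (0 + 1 * u) - b 0))
    + (H - 1/2) * (LINT u|lborel. far_kernel H t u * (b (t + 1 * u) - b t))"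
proof (cases "t = 0")
  case True
  have "near_kernel H 0 u = 0" "far_kernel H 0 u = 0" for u
    by (auto simp: near_kernel_def far_kernel_def)
  then show ?thesis using True by (simp add: tX_minus_def)
next
  case False
  have near: "(LINT s:{0..t}|lborel. s powr (H - 3/2) * b s) =
      (LINT u|lborel. near_kernel H t u * (b (0 + 1 * u) - b 0))"
    unfolding set_lebesgue_integral_def
  proof (rule integral_cong_AE)
    have "AE u in lborel. u \<noteq> t" by (rule AE_lborel_singleton)
    then show "AE u in lborel. indicator {0..t} u *\<^sub>R (u powr (H - 3/2) * b u) =
        near_kernel H t u * (b (0 + 1 * u) - b 0)"
      by eventually_elim (auto simp: near_kernel_def indicator_def b0)
  qed measurable
  have "(LINT s:{t..}|lborel. (s powr (H - 3/2) - (s - t) powr (H - 3/2)) * (b s - b t)) =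
      (LINT u|lborel. indicator {t..} (t + 1 * u) *\<^sub>R
        (((t + 1 * u) powr (H - 3/2) - (t + 1 * u - t) powr (H - 3/2)) * (b (t + 1 * u) - b t)))"
    unfolding set_lebesgue_integral_def by (subst lborel_integral_real_affine[of 1 _ t]) auto
  also have "\<dots> = (LINT u|lborel. far_kernel H t u * (b (t + 1 * u) - b t))"
  proof (rule integral_cong_AE)
    have "AE u in lborel. u \<noteq> (0::real)" by (rule AE_lborel_singleton)
    then show "AE u in lborel. indicator {t..} (t + 1 * u) *\<^sub>R
        (((t + 1 * u) powr (H - 3/2) - (t + 1 * u - t) powr (H - 3/2)) * (b (t + 1 * u) - b t)) =
        far_kernel H t u * (b (t + 1 * u) - b t)"
      by eventually_elim (auto simp: far_kernel_def indicator_def)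
  qed measurable
  finally show ?thesis
    using False by (simp only: tX_minus_def near if_False)
qed

lemma tX_continuous_on:
  assumes b: "Hoelder_growth b" and b0: "b 0 = 0"
  shows "continuous_on ({0<..<1} \<times> {0..}) (\<lambda>(H, t). tX_plus b H t)"
    and "continuous_on ({0<..<1} \<times> {0..}) (\<lambda>(H, t). tX_minus b H t)"
proof -
  let ?S = "{0<..<1::real} \<times> {0::real..}"
  have [measurable]: "b \<in> borel_measurable borel"
    using b by (auto simp: Hoelder_growth_def intro: borel_measurable_continuous_onI)
  have near: "continuous_on ?S (\<lambda>(H, t). LINT u|lborel. near_kernel H t u * (b (\<rho> t + \<sigma> * u) - b (\<rho> t)))"
    if "\<bar>\<sigma>\<bar> = 1" "continuous_on {0..} \<rho>" "\<And>t. 0 \<le> t \<Longrightarrow> 0 \<le> \<rho> t" "\<And>t. 0 \<le> t \<Longrightarrow> \<rho> t \<le> t" for \<sigma> \<rho>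
    by (rule kernel_integral_continuous_on[OF b])
       (use that in \<open>auto intro: near_kernel_bound near_kernel_tendsto\<close>)
  have far: "continuous_on ?S (\<lambda>(H, t). LINT u|lborel. far_kernel H t u * (b (\<rho> t + \<sigma> * u) - b (\<rho> t)))"
    if "\<bar>\<sigma>\<bar> = 1" "continuous_on {0..} \<rho>" "\<And>t. 0 \<le> t \<Longrightarrow> 0 \<le> \<rho> t" "\<And>t. 0 \<le> t \<Longrightarrow> \<rho> t \<le> t" for \<sigma> \<rho>
    by (rule kernel_integral_continuous_on[OF b])
       (use that in \<open>auto intro: far_kernel_bound far_kernel_tendsto\<close>)
  have H: "continuous_on ?S (\<lambda>p. fst p - 1/2)" by (intro continuous_intros)
  have "continuous_on ?S (\<lambda>p. (case p of (H, t) \<Rightarrow> t powr (H - 1/2) * b t)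
      + (fst p - 1/2) * (case p of (H, t) \<Rightarrow> LINT u|lborel. near_kernel H t u * (b (t + - 1 * u) - b t))
      + (fst p - 1/2) * (case p of (H, t) \<Rightarrow> LINT u|lborel. far_kernel H t u * (b (0 + - 1 * u) - b 0)))"
    by (intro continuous_on_add continuous_on_mult H powr_times_continuous_on b b0 near far) auto
  then show "continuous_on ?S (\<lambda>(H, t). tX_plus b H t)"
    by (rule continuous_on_cong[THEN iffD1, rotated 2]) (auto simp: tX_plus_eq b0)
  have "continuous_on ?S (\<lambda>p. - (case p of (H, t) \<Rightarrow> t powr (H - 1/2) * b t)
      + (fst p - 1/2) * (case p of (H, t) \<Rightarrow> LINT u|lborel. near_kernel H t u * (b (0 + 1 * u) - b 0))
      + (fst p - 1/2) * (case p of (H, t) \<Rightarrow> LINT u|lborel. far_kernel H t u * (b (t + 1 * u) - b t)))"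
    by (intro continuous_on_add continuous_on_minus continuous_on_mult H powr_times_continuous_on b b0 near far) auto
  then show "continuous_on ?S (\<lambda>(H, t). tX_minus b H t)"
    by (rule continuous_on_cong[THEN iffD1, rotated 2]) (auto simp: tX_minus_eq b0)
qed

subsection \<open>Evaluation of the Wiener integrals\<close>

text \<open>The Heaviside difference is 1 exactly when r < s <= r + u, that is u >= s - r >
  0.\<close>

lemma heaviside_kernel_right:
  assumes "\<And>u. u \<le> 0 \<Longrightarrow> k u = 0"
  shows "(LINT u|lborel. k u * (heaviside (r + 1 * u) s - heaviside r s)) =
    (if r < s then LINT u|lborel. k u * indicator {s - r..} u else 0)"
proof (cases "r < s")
  case True
  then have "(LINT u|lborel. k u * (heaviside (r + 1 * u) s - heaviside r s)) = (LINT u|lborel. k u * indicator {s - r..} u)"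
    by (intro Bochner_Integration.integral_cong) (auto simp: heaviside_def indicator_def)
  with True show ?thesis by simp
next
  case False
  then have zero: "k u * (heaviside (r + 1 * u) s - heaviside r s) = 0" for u
    using assms[of u] by (cases "u \<le> 0") (auto simp: heaviside_def)
  show ?thesis unfolding zero using False by simp
qed

text \<open>The difference is -1 exactly when r - u < s <= r. The strict inequality u > r - s
  differs from the closed tail at one point. At s = r every u > 0 would contribute, so that point is
  excluded.\<close>

lemma heaviside_kernel_left:
  assumes "\<And>u. u \<le> 0 \<Longrightarrow> k u = 0" and [measurable]: "k \<in> borel_measurable borel" and "s \<noteq> r"
  shows "(LINT u|lborel. k u * (heaviside (r + - 1 * u) s - heaviside r s)) =
    (if s < r then - (LINT u|lborel. k u * indicator {r - s..} u) else 0)"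
proof (cases "s < r")
  case True
  have "(LINT u|lborel. k u * (heaviside (r + - 1 * u) s - heaviside r s)) = (LINT u|lborel. - (k u * indicator {r - s..} u))"
  proof (rule integral_cong_AE)
    have "AE u in lborel. u \<noteq> r - s" by (rule AE_lborel_singleton)
    then show "AE u in lborel. k u * (heaviside (r + - 1 * u) s - heaviside r s) = - (k u * indicator {r - s..} u)"
      by eventually_elim (use True in \<open>auto simp: heaviside_def indicator_def\<close>)
  qed (unfold heaviside_def, measurable)
  with True show ?thesis by simp
next
  case False
  then have zero: "k u * (heaviside (r + - 1 * u) s - heaviside r s) = 0" for u
    using assms(1)[of u] \<open>s \<noteq> r\<close> by (cases "u \<le> 0") (auto simp: heaviside_def)
  show ?thesis unfolding zero using False by simp
qed

text \<open>\<open>Y\<close> witnesses that the choice by \<open>SOME\<close> succeeds; uniqueness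
  then identifies the chosen version with \<open>Y\<close>.\<close>

lemma (in linear_variogram) AE_wiener_integral_eq:
  assumes Y: "has_wiener_integral N Z f Y" and fg: "AE s in lborel. f s = indicator A s * g s"
    and "(\<lambda>s. indicator A s * g s) \<in> borel_measurable borel"
  shows "AE x in N. wiener_integral N Z A g x = Y x"
proof -
  have "has_wiener_integral N Z (\<lambda>s. indicator A s * g s) Y"
    by (rule has_wiener_integral_cong_AE[OF assms])
  then have "has_wiener_integral N Z (\<lambda>s. indicator A s * g s) (wiener_integral N Z A g)"
    unfolding wiener_integral_def by (rule someI[where P = "has_wiener_integral N Z (\<lambda>s. indicator A s * g s)"])
  from has_wiener_integral_unique[OF this Y] fg show ?thesis by (simp add: eq_commute)
qed

context measurable_linear_variogram
begin

lemma has_wiener_integral_near: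
  assumes H: "0 < H" "H < 1" and t: "0 < t" and \<sigma>: "\<bar>\<sigma>\<bar> = 1"
  shows "has_wiener_integral N Z
    (\<lambda>s. LINT u|lborel. c * near_kernel H t u * (heaviside (r + \<sigma> * u) s - heaviside r s))
    (\<lambda>x. LINT u|lborel. c * near_kernel H t u * (Z (r + \<sigma> * u) x - Z r x))"
proof (rule has_wiener_integral_kernel)
  show "integrable lborel (\<lambda>u. c * near_kernel H t u * sqrt \<bar>u\<bar>)"
    unfolding mult.assoc using near_kernel_bound[of H H H t t] H t
    by (intro integrable_mult_right integrable_kernel_sqrt[of _ "1 + 2 * t" H]) auto
qed (use \<sigma> in \<open>auto simp: near_kernel_def\<close>)

lemma has_wiener_integral_far:
  assumes H: "0 < H" "H < 1" and t: "0 < t" and \<sigma>: "\<bar>\<sigma>\<bar> = 1"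
  shows "has_wiener_integral N Z
    (\<lambda>s. LINT u|lborel. c * far_kernel H t u * (heaviside (r + \<sigma> * u) s - heaviside r s))
    (\<lambda>x. LINT u|lborel. c * far_kernel H t u * (Z (r + \<sigma> * u) x - Z r x))"
proof (rule has_wiener_integral_kernel)
  show "integrable lborel (\<lambda>u. c * far_kernel H t u * sqrt \<bar>u\<bar>)"
    unfolding mult.assoc using far_kernel_bound[of H H H t t] H t
    by (intro integrable_mult_right integrable_kernel_sqrt[of _ "1 + 2 * t" H]) auto
qed (use \<sigma> in \<open>auto simp: far_kernel_def\<close>)

text \<open>For s < 0, minus the far tail from y = - s is (t + y)^(H - 1/2) - y^(H - 1/2), which is
  the integrand with no correction.\<close>

lemma AE_wiener_integral_past:
  assumes H: "0 < H" "H < 1" and t: "0 < t"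
  shows "AE x in N. wiener_integral N Z {..0} (\<lambda>s. (t - s) powr (H - 1/2) - (- s) powr (H - 1/2)) x =
    (H - 1/2) * (LINT u|lborel. far_kernel H t u * (Z (0 + - 1 * u) x - Z 0 x))"
proof -
  let ?k = "\<lambda>u. (H - 1/2) * far_kernel H t u"
  have "AE s in lborel. s \<noteq> (0::real)" by (rule AE_lborel_singleton)
  then have "AE s in lborel. (LINT u|lborel. ?k u * (heaviside (0 + - 1 * u) s - heaviside 0 s)) =
      indicator {..0} s * ((t - s) powr (H - 1/2) - (- s) powr (H - 1/2))"
  proof eventually_elim
    case (elim s)
    have "(LINT u|lborel. ?k u * (heaviside (0 + - 1 * u) s - heaviside 0 s)) =
        (if s < 0 then - (LINT u|lborel. ?k u * indicator {0 - s..} u) else 0)"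
      using elim by (intro heaviside_kernel_left) (auto simp: far_kernel_def)
    then show ?case
      using elim far_kernel_tail[of "0 - s" H t] H t by (simp add: mult.assoc)
  qed
  from AE_wiener_integral_eq[OF has_wiener_integral_far[OF H t] this] show ?thesis
    by (simp add: mult.assoc)
qed

lemma AE_wiener_integral_recent:
  assumes H: "0 < H" "H < 1" and t: "0 < t"
  shows "AE x in N. wiener_integral N Z {0..t} (\<lambda>s. (t - s) powr (H - 1/2)) x =
    (H - 1/2) * (LINT u|lborel. near_kernel H t u * (Z (t + - 1 * u) x - Z t x)) +
    t powr (H - 1/2) * (Z t x - Z 0 x)"
proof -
  let ?k = "\<lambda>u. (H - 1/2) * near_kernel H t u"
  \<comment> \<open>For 0 < s < t the kernel part gives (t - s)^(H - 1/2) - t^(H - 1/2); the step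
    restores the constant.\<close>
  let ?ps = "[(t powr (H - 1/2), 0, t)]"
  have ps: "is_step ?ps" using t by (simp add: is_step_def)
  have "AE s in lborel. s \<noteq> (0::real)" "AE s in lborel. s \<noteq> t" by (rule AE_lborel_singleton)+
  then have "AE s in lborel. (LINT u|lborel. ?k u * (heaviside (t + - 1 * u) s - heaviside t s)) + step_fun ?ps s =
      indicator {0..t} s * (t - s) powr (H - 1/2)"
  proof eventually_elim
    case (elim s)
    have "(LINT u|lborel. ?k u * (heaviside (t + - 1 * u) s - heaviside t s)) =
        (if s < t then - (LINT u|lborel. ?k u * indicator {t - s..} u) else 0)"
      using elim by (intro heaviside_kernel_left) (auto simp: near_kernel_def)
    then show ?case
      using elim near_kernel_tail[of "t - s" H t] t
      by (auto simp: mult.assoc step_fun_def indicator_def)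
  qed
  from AE_wiener_integral_eq[OF has_wiener_integral_add_step[OF has_wiener_integral_near[OF H t] ps] this] show ?thesis
    by (simp add: mult.assoc step_integral_def)
qed

lemma AE_wiener_integral_initial:
  assumes H: "0 < H" "H < 1" and t: "0 < t"
  shows "AE x in N. wiener_integral N Z {0..t} (\<lambda>s. s powr (H - 1/2)) x =
    - (H - 1/2) * (LINT u|lborel. near_kernel H t u * (Z (0 + 1 * u) x - Z 0 x)) +
    t powr (H - 1/2) * (Z t x - Z 0 x)"
proof -
  \<comment> \<open>The sign is reversed because integrating to the right of the anchor yields the
    tail itself, t^(H - 1/2) - s^(H - 1/2).\<close>
  let ?k = "\<lambda>u. - (H - 1/2) * near_kernel H t u"
  let ?ps = "[(t powr (H - 1/2), 0, t)]"
  have ps: "is_step ?ps" using t by (simp add: is_step_def)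
  have "AE s in lborel. s \<noteq> (0::real)" "AE s in lborel. s \<noteq> t" by (rule AE_lborel_singleton)+
  then have "AE s in lborel. (LINT u|lborel. ?k u * (heaviside (0 + 1 * u) s - heaviside 0 s)) + step_fun ?ps s =
      indicator {0..t} s * s powr (H - 1/2)"
  proof eventually_elim
    case (elim s)
    have "(LINT u|lborel. ?k u * (heaviside (0 + 1 * u) s - heaviside 0 s)) =
        (if 0 < s then LINT u|lborel. ?k u * indicator {s - 0..} u else 0)"
      by (intro heaviside_kernel_right) (auto simp: near_kernel_def)
    moreover have "(LINT u|lborel. ?k u * indicator {s - 0..} u) =
        - ((H - 1/2) * (LINT u|lborel. near_kernel H t u * indicator {s..} u))"
      by (simp only: mult.assoc integral_mult_right_zero minus_mult_left diff_zero)
    ultimately show ?case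
      using elim near_kernel_tail[of s H t] t
      by (auto simp: step_fun_def indicator_def)
  qed
  from AE_wiener_integral_eq[OF has_wiener_integral_add_step[OF has_wiener_integral_near[OF H t] ps] this] show ?thesis
    by (simp only: mult.assoc step_integral_def integral_mult_right_zero) simp
qed

lemma AE_wiener_integral_future:
  assumes H: "0 < H" "H < 1" and t: "0 < t"
  shows "AE x in N. wiener_integral N Z {t..} (\<lambda>s. s powr (H - 1/2) - (s - t) powr (H - 1/2)) x =
    - (H - 1/2) * (LINT u|lborel. far_kernel H t u * (Z (t + 1 * u) x - Z t x))"
proof -
  let ?k = "\<lambda>u. - (H - 1/2) * far_kernel H t u"
  have "AE s in lborel. s \<noteq> t" by (rule AE_lborel_singleton)
  then have "AE s in lborel. (LINT u|lborel. ?k u * (heaviside (t + 1 * u) s - heaviside t s)) =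
      indicator {t..} s * (s powr (H - 1/2) - (s - t) powr (H - 1/2))"
  proof eventually_elim
    case (elim s)
    have "(LINT u|lborel. ?k u * (heaviside (t + 1 * u) s - heaviside t s)) =
        (if t < s then LINT u|lborel. ?k u * indicator {s - t..} u else 0)"
      by (intro heaviside_kernel_right) (auto simp: far_kernel_def)
    moreover have "(LINT u|lborel. ?k u * indicator {s - t..} u) =
        - ((H - 1/2) * (LINT u|lborel. far_kernel H t u * indicator {s - t..} u))"
      by (simp only: mult.assoc integral_mult_right_zero minus_mult_left)
    ultimately show ?case
      using elim far_kernel_tail[of "s - t" H t] H t by auto
  qed
  from AE_wiener_integral_eq[OF has_wiener_integral_far[OF H t] this] show ?thesis
    by (simp only: mult.assoc integral_mult_right_zero) simp
qed

end

section \<open>A jointly measurable version and the conclusion\<close>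

text \<open>Replacing u by floor(n u) / n leaves countably many times, which gives joint
  measurability; continuity in u gives the limit.\<close>

lemma borel_measurable_pair_of_continuous:
  fixes Z :: "real \<Rightarrow> 'a \<Rightarrow> real"
  assumes [measurable]: "\<And>u. Z u \<in> borel_measurable N" and cont: "\<And>x. continuous_on UNIV (\<lambda>u. Z u x)"
  shows "(\<lambda>(u, x). Z u x) \<in> borel_measurable (borel \<Otimes>\<^sub>M N)"
proof (rule borel_measurable_LIMSEQ_real)
  fix p :: "real \<times> 'a"
  have "(\<lambda>n. \<lfloor>real n * fst p\<rfloor> / real n) \<longlonglongrightarrow> fst p"
  proof (rule LIM_zero_cancel, rule Lim_null_comparison[OF _ lim_1_over_n])
    have "norm (\<lfloor>real n * fst p\<rfloor> / real n - fst p) \<le> 1 / real n" if "0 < n" for n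
    proof -
      have "\<lfloor>real n * fst p\<rfloor> / real n - fst p = (\<lfloor>real n * fst p\<rfloor> - real n * fst p) / real n"
        using that by (simp add: diff_divide_distrib)
      then have "norm (\<lfloor>real n * fst p\<rfloor> / real n - fst p) = \<bar>\<lfloor>real n * fst p\<rfloor> - real n * fst p\<bar> / real n"
        by (simp add: abs_divide)
      also have "\<dots> \<le> 1 / real n" by (intro divide_right_mono) (linarith, simp)
      finally show ?thesis .
    qed
    then show "\<forall>\<^sub>F n in sequentially. norm (\<lfloor>real n * fst p\<rfloor> / real n - fst p) \<le> 1 / real n"
      using eventually_gt_at_top[of 0] by (rule eventually_mono[rotated])
  qed
  from continuous_on_tendsto_compose[OF cont this]
  show "(\<lambda>n. Z (\<lfloor>real n * fst p\<rfloor> / real n) (snd p)) \<longlonglongrightarrow> (case p of (u, x) \<Rightarrow> Z u x)"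
    by (simp add: split_beta)
next
  fix n :: nat
  show "(\<lambda>p. Z (\<lfloor>real n * fst p\<rfloor> / real n) (snd p)) \<in> borel_measurable (borel \<Otimes>\<^sub>M N)"
    by (rule measurable_compose_countable[where f = "\<lambda>i p. Z (real_of_int i / real n) (snd p)"
          and g = "\<lambda>p. \<lfloor>real n * fst p\<rfloor>"]) measurable
qed

lemma two_sided_BM_continuous_version:
  assumes BM: "two_sided_BM M B"
  obtains B' where "measurable_linear_variogram M B'" "AE \<omega> in M. \<forall>t. B' t \<omega> = B t \<omega>"
proof -
  interpret prob_space M using BM by (simp add: two_sided_BM_def)
  have [measurable]: "B t \<in> borel_measurable M" for t
    using BM by (simp add: two_sided_BM_def)
  have "AE \<omega> in M. continuous_on UNIV (\<lambda>t. B t \<omega>)"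
    using BM by (simp add: two_sided_BM_def)
  \<comment> \<open>The set of discontinuous paths need not be measurable; the process is set to 0
    on a measurable null set that contains it.\<close>
  then obtain E where E: "{\<omega> \<in> space M. \<not> continuous_on UNIV (\<lambda>t. B t \<omega>)} \<subseteq> E" "emeasure M E = 0" "E \<in> sets M"
    by (rule AE_E)
  note [measurable] = E(3)
  define B' where "B' t \<omega> = indicator (space M - E) \<omega> * B t \<omega>" for t \<omega>
  have meas: "B' t \<in> borel_measurable M" for t
    unfolding B'_def by measurable
  have "AE \<omega> in M. \<omega> \<notin> E"
    using E by (intro AE_not_in null_setsI)
  then have eq: "AE \<omega> in M. \<forall>t. B' t \<omega> = B t \<omega>"
    using AE_space by eventually_elim (simp add: B'_def)
  have "continuous_on UNIV (\<lambda>t. B' t \<omega>)" for \<omega>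
    using E(1) by (cases "\<omega> \<in> space M - E") (auto simp: B'_def)
  then have joint: "(\<lambda>(u, \<omega>). B' u \<omega>) \<in> borel_measurable (borel \<Otimes>\<^sub>M M)"
    by (intro borel_measurable_pair_of_continuous meas)
  have "(\<integral>\<^sup>+\<omega>. ennreal ((B' u \<omega> - B' v \<omega>)\<^sup>2) \<partial>M) = ennreal \<bar>u - v\<bar>" for u v
  proof -
    have "(\<integral>\<^sup>+\<omega>. ennreal ((B' u \<omega> - B' v \<omega>)\<^sup>2) \<partial>M) = (\<integral>\<^sup>+\<omega>. ennreal ((B u \<omega> - B v \<omega>)\<^sup>2) \<partial>M)"
      by (rule nn_integral_cong_AE) (use eq in eventually_elim, simp)
    then show ?thesis using two_sided_BM_moment[OF BM, of u v 1] by simp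
  qed
  with joint meas have "measurable_linear_variogram M B'"
    by unfold_locales
  with eq that show ?thesis by blast
qed

theorem corollary1:
  fixes M :: "'w measure" and B :: "real \<Rightarrow> 'w \<Rightarrow> real" and c :: "real \<times> real"
  assumes "two_sided_BM M B" and "c \<noteq> (0, 0)"
  shows "continuous_modification M ({0<..<1} \<times> {0..}) (tX_field B c) (X_field M B c)"
proof -
  note BM = \<open>two_sided_BM M B\<close>
  obtain B' where B': "measurable_linear_variogram M B'" and eq: "AE \<omega> in M. \<forall>t. B' t \<omega> = B t \<omega>"
    using two_sided_BM_continuous_version[OF BM] .
  interpret B': measurable_linear_variogram M B' by (rule B')
  have "has_wiener_integral M B = has_wiener_integral M B'"
  proof (rule has_wiener_integral_cong_AE_process)
    show "AE \<omega> in M. B t \<omega> = B' t \<omega>" for t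
      using eq by eventually_elim simp
  qed (use BM in \<open>auto simp: two_sided_BM_def\<close>)
  \<comment> \<open>Equal predicates have the same \<open>SOME\<close>, so this is an identity and
    not just almost sure equality.\<close>
  then have wiener: "wiener_integral M B A f = wiener_integral M B' A f" for A f
    by (simp add: wiener_integral_def fun_eq_iff)
  have good: "AE \<omega> in M. Hoelder_growth (\<lambda>t. B t \<omega>) \<and> B 0 \<omega> = 0"
    using two_sided_BM_Hoelder_growth[OF BM] BM by (simp add: two_sided_BM_def)
  have "AE \<omega> in M. continuous_on ({0<..<1} \<times> {0..}) (\<lambda>p. tX_field B c p \<omega>)"
    using good
  proof eventually_elim
    case (elim \<omega>)
    have "continuous_on ({0<..<1} \<times> {0..}) (\<lambda>p. fst c * (case p of (H, t) \<Rightarrow> tX_plus (\<lambda>s. B s \<omega>) H t)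
        + snd c * (case p of (H, t) \<Rightarrow> tX_minus (\<lambda>s. B s \<omega>) H t))"
      using elim by (intro continuous_intros tX_continuous_on) auto
    then show ?case by (simp add: tX_field_def split_beta)
  qed
  moreover have "AE \<omega> in M. tX_field B c (H, t) \<omega> = X_field M B c (H, t) \<omega>"
    if H: "0 < H" "H < 1" and t: "0 \<le> t" for H t
  proof (cases "t = 0")
    case True
    then show ?thesis
      by (simp add: tX_field_def X_field_def tX_plus_def X_plus_def tX_minus_def X_minus_def)
  next
    case False
    with t have "0 < t" by simp
    from good eq B'.AE_wiener_integral_past[OF H this] B'.AE_wiener_integral_recent[OF H this]
      B'.AE_wiener_integral_initial[OF H this] B'.AE_wiener_integral_future[OF H this]
    show ?thesis
    proof eventually_elim
      case (elim \<omega>)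
      have meas: "(\<lambda>s. B s \<omega>) \<in> borel_measurable borel"
        using elim by (auto simp: Hoelder_growth_def intro: borel_measurable_continuous_onI)
      \<comment> \<open>This reduces the boundary terms t^(H - 1/2) (B t - B 0) to those in the
        pathwise formulas.\<close>
      have b0: "B 0 \<omega> = 0" using elim by simp
      have "tX_plus (\<lambda>s. B s \<omega>) H t = X_plus M B H t \<omega>"
        unfolding tX_plus_eq[OF meas b0 t] X_plus_def wiener using elim False by simp
      moreover have "tX_minus (\<lambda>s. B s \<omega>) H t = X_minus M B H t \<omega>"
        unfolding tX_minus_eq[OF meas b0 t] X_minus_def wiener using elim False
        by (simp add: left_diff_distrib)
      ultimately show ?case
        by (simp add: tX_field_def X_field_def)
    qed
  qed
  ultimately show ?thesis
    unfolding continuous_modification_def by auto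
qed

end
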